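(* Let $R$ be a reduced finitely generated $\mathbb{C}$-algebra which is a unique factorization domain, and let $Y=\operatorname{mSpec}R$. Let $s\in\overline{\operatorname{Frac}R}$, let $X=\operatorname{mSpec}(R[s])$, and let $\pi:X\to Y$ be the morphism induced by the inclusion $R\to R[s]$. Then $s\in\operatorname{PC}(R)$ if and only if $\pi$ is surjective up to codimension two.
   Context: $\operatorname{mSpec}$ denotes the variety of closed points (maximal ideals) of a reduced finitely generated $\mathbb{C}$-algebra; $\overline{\operatorname{Frac}R}$ is an algebraic closure of the fraction field. The positive closure of an integral domain $R$ is $\operatorname{PC}(R)=\{s\in\overline{\operatorname{Frac}R} : R[s]\cap\operatorname{Frac}R=R\}$. A morphism of varieties $\pi:X\to Y$ is surjective up to codimension two if every irreducible component of the Zariski closure $\overline{Y\setminus\operatorname{im}\pi}$ has codimension at least $2$ in $Y$ (vacuously true if $\pi$ is surjective). *)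

theory Defs
  imports
    "HOL-Analysis.Abstract_Topology"
    "HOL-Library.Extended_Nat"
    "HOL-Computational_Algebra.Fraction_Field"
    "HOL-Algebra.Algebraic_Closure_Type"
    "HOL-Algebra.Ring_Divisibility"
    "HOL-Algebra.Generated_Rings"
begin

section \<open>Reduced finitely generated complex algebras\<close>

text \<open>The algebra structure is given by its structure map \<open>\<phi>\<close> from the complex numbers.\<close>

definition reduced_fg_complex_algebra :: "(complex \<Rightarrow> 'a::comm_ring_1) \<Rightarrow> bool" where
  "reduced_fg_complex_algebra \<phi> \<longleftrightarrow>
     \<phi> \<in> ring_hom ring_of_type_algebra ring_of_type_algebra \<and>
     (\<exists>S. finite S \<and> generate_ring ring_of_type_algebra (range \<phi> \<union> S) = UNIV) \<and>
     (\<forall>(x::'a) (n::nat). x ^ n = 0 \<longrightarrow> x = 0)"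


section \<open>Adjoining an element of the algebraic closure and the positive closure\<close>

text \<open>For a domain \<open>R\<close> of type \<open>'a\<close>, the type \<open>'a fract alg_closure\<close> is the algebraic closure
  of its fraction field.  There, the copy of \<open>R\<close> is \<open>range of_domain\<close> and the copy of the
  fraction field is \<open>range to_ac\<close>.\<close>

definition of_domain :: "'a::idom \<Rightarrow> 'a fract alg_closure" where
  "of_domain r = to_ac (Fract r 1)"

definition adjoin :: "'a::idom fract alg_closure \<Rightarrow> 'a fract alg_closure set" where
  "adjoin s = range (\<lambda>p::'a poly. poly (map_poly of_domain p) s)"

definition adjoin_ring :: "'a::idom fract alg_closure \<Rightarrow> 'a fract alg_closure ring" where
  "adjoin_ring s = ring_of_type_algebra\<lparr>carrier := adjoin s\<rparr>"

definition positive_closure :: "'a::idom fract alg_closure set" where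
  "positive_closure =
     {s. adjoin s \<inter> range (to_ac :: 'a fract \<Rightarrow> 'a fract alg_closure) = range of_domain}"


section \<open>The maximal spectrum\<close>

definition mSpec :: "('a, 'm) ring_scheme \<Rightarrow> 'a set set" where
  "mSpec R = {M. maximalideal M R}"

definition zariski :: "('a, 'm) ring_scheme \<Rightarrow> 'a set topology" where
  "zariski R = topology_generated_by {{M \<in> mSpec R. f \<notin> M} | f. f \<in> carrier R}"

definition mSpec_map ::
  "('a, 'm) ring_scheme \<Rightarrow> ('a \<Rightarrow> 'b) \<Rightarrow> 'b set \<Rightarrow> 'a set" where
  "mSpec_map R h M = {r \<in> carrier R. h r \<in> M}"

lemma topspace_zariski: "topspace (zariski R) = mSpec R" if "ring R"
proof -
  interpret ring R by fact
  have "\<one>\<^bsub>R\<^esub> \<notin> M" if M: "M \<in> mSpec R" for M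
  proof -
    interpret maximalideal M R using M by (simp add: mSpec_def)
    show ?thesis using I_notcarr one_imp_carrier by metis
  qed
  hence "mSpec R = {M \<in> mSpec R. \<one>\<^bsub>R\<^esub> \<notin> M}" by auto
  hence "mSpec R \<in> {{M \<in> mSpec R. f \<notin> M} | f. f \<in> carrier R}"
    using one_closed by auto
  hence "mSpec R \<subseteq> \<Union> {{M \<in> mSpec R. f \<notin> M} | f. f \<in> carrier R}"
    by (rule Union_upper)
  moreover have "\<Union> {{M \<in> mSpec R. f \<notin> M} | f. f \<in> carrier R} \<subseteq> mSpec R"
    by blast
  ultimately show ?thesis
    unfolding zariski_def topology_generated_by_topspace by (rule equalityI[rotated])
qed


section \<open>Irreducible components, codimension, surjectivity up to codimension two\<close>

definition irreducible_in :: "'a topology \<Rightarrow> 'a set \<Rightarrow> bool" where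
  "irreducible_in T Z \<longleftrightarrow> Z \<subseteq> topspace T \<and> Z \<noteq> {} \<and>
     (\<forall>C D. closedin (subtopology T Z) C \<and> closedin (subtopology T Z) D \<and> Z = C \<union> D
        \<longrightarrow> C = Z \<or> D = Z)"

definition irreducible_components :: "'a topology \<Rightarrow> 'a set \<Rightarrow> 'a set set" where
  "irreducible_components T S =
     {Z. irreducible_in T Z \<and> Z \<subseteq> S \<and>
         (\<forall>Z'. irreducible_in T Z' \<and> Z' \<subseteq> S \<and> Z \<subseteq> Z' \<longrightarrow> Z' = Z)}"

text \<open>The codimension of an irreducible closed set \<open>Z\<close> is the supremum of the lengths of the
  chains of irreducible closed sets that ascend strictly from \<open>Z\<close>.\<close>

definition codimension :: "'a topology \<Rightarrow> 'a set \<Rightarrow> enat" where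
  "codimension T Z =
     (SUP n \<in> {n. \<exists>W. W 0 = Z \<and> (\<forall>i\<le>n. closedin T (W i) \<and> irreducible_in T (W i)) \<and>
                      (\<forall>i<n. W i \<subset> W (Suc i))}. enat n)"

definition surjective_up_to_codim_two ::
  "'a topology \<Rightarrow> 'b topology \<Rightarrow> ('a \<Rightarrow> 'b) \<Rightarrow> bool" where
  "surjective_up_to_codim_two S T f \<longleftrightarrow>
     (\<forall>Z \<in> irreducible_components T
            (Abstract_Topology.closure_of T (topspace T - f ` topspace S)).
        2 \<le> codimension T Z)"

end

theory Submission
  imports Defs "HOL-Analysis.Continuum_Not_Denumerable"
begin

text \<open>Let \<open>f = a\<^sub>0 + a\<^sub>1 t + \<dots> + a\<^sub>n t\<^sup>n\<close> be a primitive polynomial over \<open>R\<close> of minimal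
  degree with \<open>f(s) = 0\<close>.  By Gauss's lemma \<open>R[s] = R[t]/(f)\<close>.  A maximal ideal \<open>M\<close> of \<open>R\<close> is not in
  the image of \<open>\<pi>\<close> iff \<open>f\<close> is a nonzero constant modulo \<open>M\<close>, so
  \<open>Y \<setminus> im \<pi>\<close> is the set where \<open>a\<^sub>1, \<dots>, a\<^sub>n\<close> vanish but \<open>a\<^sub>0\<close> does not.  The same computation
  modulo a prime element shows that \<open>s\<close> lies in the positive closure iff no prime element divides all
  of \<open>a\<^sub>1, \<dots>, a\<^sub>n\<close>.  If a prime element \<open>q\<close> divides all of them, then \<open>V(q)\<close> is a component of
  codimension one of the closure of \<open>Y \<setminus> im \<pi>\<close>; otherwise every component \<open>Z\<close> has a chain
  \<open>Z \<subset> V(p) \<subset> Y\<close>, where \<open>p\<close> is a prime element in the ideal of \<open>Z\<close>.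
  Both directions need that \<open>R\<close> is a Jacobson ring, which follows from the uncountability of the
  complex numbers.\<close>

section \<open>Ideals\<close>

lemma ring_of_type_algebra_simps [simp]:
  "carrier (ring_of_type_algebra :: 'b::comm_ring_1 ring) = UNIV"
  "x \<otimes>\<^bsub>ring_of_type_algebra\<^esub> y = x * (y :: 'b)"
  "x \<oplus>\<^bsub>ring_of_type_algebra\<^esub> y = x + (y :: 'b)"
  "\<one>\<^bsub>ring_of_type_algebra\<^esub> = (1 :: 'b)"
  "\<zero>\<^bsub>ring_of_type_algebra\<^esub> = (0 :: 'b)"
  by (simp_all add: ring_of_type_algebra_def)

lemma ring_of_type_algebra_UNIV: "ring_of_type_algebra\<lparr>carrier := UNIV\<rparr> = ring_of_type_algebra"
  by (simp add: ring_of_type_algebra_def)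

lemma cring_carrier_update:
  fixes C :: "'b::comm_ring_1 set"
  assumes "0 \<in> C" "1 \<in> C" "\<And>x. x \<in> C \<Longrightarrow> - x \<in> C"
    and "\<And>x y. x \<in> C \<Longrightarrow> y \<in> C \<Longrightarrow> x + y \<in> C" "\<And>x y. x \<in> C \<Longrightarrow> y \<in> C \<Longrightarrow> x * y \<in> C"
  shows "cring (ring_of_type_algebra\<lparr>carrier := C\<rparr>)"
proof -
  have "\<exists>y\<in>C. x + y = 0" if "x \<in> C" for x
    using assms(3)[OF that] by (intro bexI[of _ "- x"]) auto
  then show ?thesis
    using assms by unfold_locales (auto simp: Units_def algebra_simps)
qed

text \<open>Closure under negation comes from absorption: -1 lies in \<open>C\<close>, so
  \<open>- a = -1 * a\<close> lies in \<open>I\<close>. A general \<open>C\<close> covers both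
  \<open>R\<close> and \<open>R[s]\<close>.\<close>

lemma ideal_carrier_update_iff:
  fixes C :: "'b::comm_ring_1 set"
  assumes "cring (ring_of_type_algebra\<lparr>carrier := C\<rparr>)" (is "cring ?R")
  shows "ideal I (ring_of_type_algebra\<lparr>carrier := C\<rparr>) \<longleftrightarrow>
    I \<subseteq> C \<and> 0 \<in> I \<and> (\<forall>a\<in>I. \<forall>b\<in>I. a + b \<in> I) \<and> (\<forall>x\<in>C. \<forall>a\<in>I. x * a \<in> I)"
    (is "_ \<longleftrightarrow> ?rhs")
proof
  interpret cring ?R by fact
  show ?rhs if "ideal I ?R"
  proof -
    interpret ideal I ?R by fact
    show ?thesis
      using a_subset zero_closed a_closed I_l_closed by simp
  qed
  show "ideal I ?R" if r: ?rhs
  proof (rule idealI)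
    have minus: "\<ominus>\<^bsub>?R\<^esub> x = - x" if "x \<in> C" for x
    proof -
      have "x + \<ominus>\<^bsub>?R\<^esub> x = 0" using r_neg[of x] that by simp
      then show ?thesis by (rule Groups.minus_unique[symmetric])
    qed
    have m: "-1 \<in> C"
      using a_inv_closed[OF one_closed] minus[of 1] one_closed by simp
    show "subgroup I (add_monoid ?R)"
    proof (rule group.subgroupI[OF a_group])
      show "inv\<^bsub>add_monoid ?R\<^esub> a \<in> I" if "a \<in> I" for a
      proof -
        have "\<ominus>\<^bsub>?R\<^esub> a = - a" using minus that r by blast
        moreover have "-1 * a \<in> I" using r m that by blast
        ultimately show ?thesis by (simp add: a_inv_def)
      qed
    qed (use r in auto)
    show "ring ?R" by (rule ring_axioms)
    show l: "x \<otimes>\<^bsub>?R\<^esub> a \<in> I" if "a \<in> I" "x \<in> carrier ?R" for a x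
      using that r by simp
    show "a \<otimes>\<^bsub>?R\<^esub> x \<in> I" if "a \<in> I" "x \<in> carrier ?R" for a x
      using l[OF that] by (simp add: mult.commute)
  qed
qed

lemma ideal_type_iff:
  fixes I :: "'b::comm_ring_1 set"
  shows "ideal I ring_of_type_algebra \<longleftrightarrow>
    0 \<in> I \<and> (\<forall>a\<in>I. \<forall>b\<in>I. a + b \<in> I) \<and> (\<forall>x. \<forall>a\<in>I. x * a \<in> I)"
proof -
  have "cring (ring_of_type_algebra\<lparr>carrier := UNIV :: 'b set\<rparr>)"
    by (simp add: ring_of_type_algebra_UNIV cring_from_type_algebra)
  from ideal_carrier_update_iff[OF this] show ?thesis by (simp add: ring_of_type_algebra_UNIV)
qed

lemma primeideal_type_iff:
  fixes P :: "'b::comm_ring_1 set"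
  shows "primeideal P ring_of_type_algebra \<longleftrightarrow>
    ideal P ring_of_type_algebra \<and> 1 \<notin> P \<and> (\<forall>a b. a * b \<in> P \<longrightarrow> a \<in> P \<or> b \<in> P)"
proof -
  have *: "UNIV \<noteq> P \<longleftrightarrow> 1 \<notin> P" if "ideal P ring_of_type_algebra"
    using ideal.one_imp_carrier[OF that] by auto
  show ?thesis
    unfolding primeideal_def primeideal_axioms_def
    by (metis * cring_from_type_algebra ring_of_type_algebra_simps(1,2) UNIV_I)
qed

lemma primeideal_type_mult_iff:
  fixes P :: "'b::comm_ring_1 set"
  assumes "primeideal P ring_of_type_algebra"
  shows "a * b \<in> P \<longleftrightarrow> a \<in> P \<or> b \<in> P"
  using assms unfolding primeideal_type_iff ideal_type_iff by (metis mult.commute)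

lemma ideal_type_diff:
  fixes I :: "'b::comm_ring_1 set"
  assumes "ideal I ring_of_type_algebra" "a \<in> I" "b \<in> I"
  shows "a - b \<in> I"
proof -
  have "a + (-1) * b \<in> I" using assms unfolding ideal_type_iff by blast
  then show ?thesis by simp
qed

lemma ideal_type_sum:
  fixes I :: "'b::comm_ring_1 set"
  assumes "ideal I ring_of_type_algebra" "\<And>x. x \<in> A \<Longrightarrow> f x \<in> I"
  shows "sum f A \<in> I"
  using assms(2) by (induction A rule: infinite_finite_induct) (use assms(1) in \<open>auto simp: ideal_type_iff\<close>)

text \<open>When each \<open>a\<close> outside \<open>M\<close> is invertible modulo
  \<open>M\<close>, an ideal strictly above \<open>M\<close> contains some \<open>x * a\<close> and
  \<open>1 - x * a\<close>, hence 1.\<close>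

lemma maximalideal_typeI:
  fixes M :: "'b::comm_ring_1 set"
  assumes "ideal M ring_of_type_algebra" "1 \<notin> M" "\<And>a. a \<notin> M \<Longrightarrow> \<exists>x. 1 - x * a \<in> M"
  shows "maximalideal M ring_of_type_algebra"
proof (rule maximalidealI)
  fix J assume J: "ideal J (ring_of_type_algebra :: 'b ring)" "M \<subseteq> J"
  show "J = M \<or> J = carrier ring_of_type_algebra"
  proof (cases "J = M")
    case False
    then obtain a where a: "a \<in> J" "a \<notin> M" using J by auto
    obtain x where "1 - x * a \<in> M" using assms(3) a by blast
    moreover have "x * a \<in> J" using J a by (auto simp: ideal_type_iff)
    ultimately have "(1 - x * a) + x * a \<in> J" using J unfolding ideal_type_iff by blast
    then show ?thesis using ideal.one_imp_carrier[OF J(1)] by simp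
  qed simp
qed (use assms in auto)

lemma maximalideal_type_primeideal:
  "maximalideal M (ring_of_type_algebra :: 'b::comm_ring_1 ring) \<Longrightarrow> primeideal M ring_of_type_algebra"
  by (rule cring.maximalideal_prime[OF cring_from_type_algebra])

text \<open>Zorn's lemma for the ideals above \<open>J\<close> that omit 1. The carrier-based form
  is needed for \<open>R[s]\<close>, a subring of the algebraic closure.\<close>

lemma (in ring) exists_maximalideal_containing:
  assumes "ideal J R" "\<one> \<notin> J"
  shows "\<exists>M. maximalideal M R \<and> J \<subseteq> M"
proof -
  let ?A = "{I. ideal I R \<and> J \<subseteq> I \<and> \<one> \<notin> I}"
  have "\<exists>M\<in>?A. \<forall>I\<in>?A. M \<subseteq> I \<longrightarrow> I = M"
  proof (rule subset_Zorn_nonempty)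
    fix C assume C: "C \<noteq> {}" "subset.chain ?A C"
    then have "subset.chain {I. ideal I R} C" by (auto simp: subset_chain_def)
    from chain_Union_is_ideal[OF this] C(1) have idl: "ideal (\<Union>C) R" by simp
    have "C \<subseteq> ?A" using C(2) by (simp add: subset_chain_def)
    then show "\<Union>C \<in> ?A" using idl C(1) by blast
  qed (use assms in auto)
  then obtain M where M: "M \<in> ?A" "\<forall>I\<in>?A. M \<subseteq> I \<longrightarrow> I = M" by blast
  have "maximalideal M R"
  proof (rule maximalidealI)
    fix I assume I: "ideal I R" "M \<subseteq> I" "I \<subseteq> carrier R"
    have "I = M" if "\<one> \<notin> I"
      using M I that by blast
    then show "I = M \<or> I = carrier R"
      using ideal.one_imp_carrier[OF I(1)] by blast
  qed (use M in auto)
  then show ?thesis using M by blast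
qed

section \<open>The Jacobson property\<close>

lemma ring_hom_typeD:
  assumes "\<phi> \<in> ring_hom (ring_of_type_algebra :: 'k::comm_ring_1 ring) (ring_of_type_algebra :: 'b::comm_ring_1 ring)"
  shows "\<phi> (x + y) = \<phi> x + \<phi> y" "\<phi> (x * y) = \<phi> x * \<phi> y" "\<phi> 1 = 1" "\<phi> 0 = 0" "\<phi> (- x) = - \<phi> x"
proof -
  have add: "\<phi> (x + y) = \<phi> x + \<phi> y" for x y
    using ring_hom_add[OF assms, of x y] by simp
  then show "\<phi> (x + y) = \<phi> x + \<phi> y" .
  show "\<phi> (x * y) = \<phi> x * \<phi> y" using ring_hom_mult[OF assms, of x y] by simp
  show "\<phi> 1 = 1" using ring_hom_one[OF assms] by simp
  show zero: "\<phi> 0 = 0" using add[of 0 0] by simp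
  have "\<phi> x + \<phi> (- x) = 0" using add[of x "- x"] zero by simp
  then show "\<phi> (- x) = - \<phi> x" by (rule Groups.minus_unique[symmetric])
qed

section \<open>Algebras of countable dimension\<close>

lemma vector_space_ring_hom:
  assumes "\<phi> \<in> ring_hom (ring_of_type_algebra :: 'k::field ring) (ring_of_type_algebra :: 'b::comm_ring_1 ring)"
  shows "vector_space (\<lambda>c x. \<phi> c * x)"
  by unfold_locales (simp_all add: ring_hom_typeD[OF assms] algebra_simps)

text \<open>Finite products of elements of \<open>S\<close> span: they are closed under
  multiplication, hence so is their span, which contains the generators.\<close>

lemma countable_spanning_set:
  fixes \<phi> :: "'k::field \<Rightarrow> 'b::comm_ring_1"
  assumes hom: "\<phi> \<in> ring_hom ring_of_type_algebra ring_of_type_algebra"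
    and "countable S" and gen: "generate_ring ring_of_type_algebra (range \<phi> \<union> S) = UNIV"
  shows "\<exists>B. countable B \<and> module.span (\<lambda>c x. \<phi> c * x) B = UNIV"
proof -
  interpret vector_space "\<lambda>c x. \<phi> c * x" by (rule vector_space_ring_hom[OF hom])
  note [simp] = ring_hom_typeD[OF hom]
  define B where "B = prod_list ` lists S"
  have B: "prod_list xs \<in> B" if "set xs \<subseteq> S" for xs
    using that unfolding B_def by (intro imageI) (simp add: in_lists_conv_set subset_eq)
  have B1: "1 \<in> B" using B[of "[]"] by simp
  have BS: "x \<in> B" if "x \<in> S" for x using B[of "[x]"] that by simp
  have BB: "x * y \<in> B" if xy: "x \<in> B" "y \<in> B" for x y
  proof -
    obtain xs ys where "x = prod_list xs" "y = prod_list ys" "set xs \<subseteq> S" "set ys \<subseteq> S"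
      using xy unfolding B_def by (auto simp: in_lists_conv_set)
    then show ?thesis using B[of "xs @ ys"] by simp
  qed
  have 1: "b * x \<in> span B" if b: "b \<in> B" and "x \<in> span B" for b x
    using that(2)
  proof (induction rule: span_induct_alt)
    case (step c x y)
    have "b * x \<in> span B" using step BB[OF b] by (simp add: span_base)
    from span_add[OF span_scale[OF this, of c]] step
    have "\<phi> c * (b * x) + b * y \<in> span B" by simp
    then show ?case by (simp add: algebra_simps)
  qed (simp add: span_zero)
  have 2: "y * x \<in> span B" if "y \<in> span B" "x \<in> span B" for x y
    using that(1)
  proof (induction rule: span_induct_alt)
    case (step c b y)
    have "\<phi> c * (b * x) + y * x \<in> span B"
      using step 1[OF _ that(2)] by (simp add: span_add span_scale)
    then show ?case by (simp add: algebra_simps)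
  qed (simp add: span_zero)
  have "x \<in> span B" if "x \<in> generate_ring ring_of_type_algebra (range \<phi> \<union> S)" for x
    using that
  proof induction
    case one
    then show ?case using B1 by (simp add: span_base)
  next
    case (incl h)
    have "\<phi> c \<in> span B" for c
      using span_scale[OF span_base[OF B1], of c] by simp
    then show ?case using incl BS by (auto intro: span_base)
  next
    case (a_inv h)
    have "h + \<ominus>\<^bsub>ring_of_type_algebra\<^esub> h = 0"
      using abelian_group.r_neg[OF ring.is_abelian_group[OF ring_from_type_algebra], of h] by simp
    then have "\<ominus>\<^bsub>ring_of_type_algebra\<^esub> h = - h"
      by (rule Groups.minus_unique[symmetric])
    then show ?case using a_inv by (simp add: span_neg)
  next
    case (eng_add h1 h2)
    then show ?case by (simp add: span_add)
  next
    case (eng_mult h1 h2)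
    then show ?case by (simp add: 2)
  qed
  then have "span B = UNIV" using gen by auto
  moreover have "countable B" unfolding B_def using assms by (intro countable_image countable_lists)
  ultimately show ?thesis by blast
qed

text \<open>\<open>B\<close> has only countably many finite subsets, and an independent set meets
  the span of each in a finite set; so independent sets are countable. The form with a family
  \<open>v\<close> allows repeated values.\<close>

lemma (in vector_space) uncountable_imp_dependent_relation:
  assumes "countable B" "span B = UNIV" "uncountable A"
  shows "\<exists>F u. finite F \<and> F \<subseteq> A \<and> (\<exists>x\<in>F. u x \<noteq> 0) \<and> (\<Sum>x\<in>F. scale (u x) (v x)) = 0"
proof (cases "inj_on v A")
  case False
  then obtain x y where xy: "x \<in> A" "y \<in> A" "x \<noteq> y" "v x = v y" by (auto simp: inj_on_def)
  \<comment> \<open>Two equal vectors give the relation \<open>v x - v y = 0\<close>.\<close>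
  let ?u = "\<lambda>z. if z = x then 1 else - 1 :: 'a"
  have "(\<Sum>z\<in>{x, y}. scale (?u z) (v z)) = 0"
    using xy by simp
  moreover have "\<exists>z\<in>{x, y}. ?u z \<noteq> 0" by simp
  ultimately show ?thesis
    using xy(1,2) by (intro exI[of _ "{x, y}"] exI[of _ ?u]) simp
next
  case inj: True
  have "dependent (v ` A)"
  proof (rule ccontr)
    assume ind: "independent (v ` A)"
    have unc: "uncountable (v ` A)" using assms(3) inj by (simp add: countable_image_inj_eq)
    have "v ` A \<subseteq> (\<Union>T\<in>{T. finite T \<and> T \<subseteq> B}. v ` A \<inter> span T)"
    proof
      fix x assume x: "x \<in> v ` A"
      have "x \<in> span B" using assms by simp
      then obtain T r where "finite T" "T \<subseteq> B" "x = (\<Sum>a\<in>T. scale (r a) a)"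
        unfolding span_explicit by blast
      then have "x \<in> span T" by (simp add: span_sum span_scale span_base)
      then show "x \<in> (\<Union>T\<in>{T. finite T \<and> T \<subseteq> B}. v ` A \<inter> span T)"
        using x \<open>finite T\<close> \<open>T \<subseteq> B\<close> by blast
    qed
    moreover have "countable (\<Union>T\<in>{T. finite T \<and> T \<subseteq> B}. v ` A \<inter> span T)"
    proof (rule countable_UN)
      show "countable {T. finite T \<and> T \<subseteq> B}"
        using assms(1) by (rule countable_Collect_finite_subset)
      show "countable (v ` A \<inter> span T)" if "T \<in> {T. finite T \<and> T \<subseteq> B}" for T
      proof -
        have "independent (v ` A \<inter> span T)" using ind by (rule independent_mono) simp
        then have "finite (v ` A \<inter> span T)"
          using independent_span_bound[of T "v ` A \<inter> span T"] that by simp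
        then show ?thesis by (rule countable_finite)
      qed
    qed
    ultimately show False using unc countable_subset by blast
  qed
  then obtain T u w where T: "finite T" "T \<subseteq> v ` A" "(\<Sum>w\<in>T. scale (u w) w) = 0" "w \<in> T" "u w \<noteq> 0"
    unfolding dependent_explicit by blast
  from finite_subset_image[OF T(1,2)]
  obtain F where "F \<subseteq> A" "finite F" "T = v ` F" by blast
  with inj have F: "F \<subseteq> A" "finite F" "T = v ` F" "inj_on v F" by (auto intro: inj_on_subset)
  have "(\<Sum>x\<in>F. scale (u (v x)) (v x)) = 0"
    using T(3) F sum.reindex[OF F(4), of "\<lambda>w. scale (u w) w"] by simp
  moreover have "\<exists>x\<in>F. u (v x) \<noteq> 0" using T(4,5) F(3) by blast
  ultimately show ?thesis using F(1,2) by (intro exI[of _ F] exI[of _ "\<lambda>x. u (v x)"]) simp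
qed

section \<open>Prime ideals and the Nullstellensatz\<close>

lemma map_poly_hom:
  fixes f :: "'k::comm_ring_1 \<Rightarrow> 'b::comm_ring_1"
  assumes hom: "f \<in> ring_hom ring_of_type_algebra ring_of_type_algebra"
  shows "map_poly f (p + q) = map_poly f p + map_poly f q"
    and "map_poly f (p * q) = map_poly f p * map_poly f q"
    and "map_poly f (- p) = - map_poly f p"
    and "map_poly f (p - q) = map_poly f p - map_poly f q"
    and "map_poly f (smult c p) = smult (f c) (map_poly f p)"
    and "map_poly f (pCons c p) = pCons (f c) (map_poly f p)"
proof -
  note [simp] = ring_hom_typeD[OF hom]
  have sum: "f (sum g A) = (\<Sum>x\<in>A. f (g x))" for g and A :: "nat set"
    by (induction A rule: infinite_finite_induct) auto
  show add: "map_poly f (p + q) = map_poly f p + map_poly f q" for p q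
    by (rule poly_eqI) (simp add: coeff_map_poly)
  show "map_poly f (p * q) = map_poly f p * map_poly f q"
    by (rule poly_eqI) (simp add: coeff_map_poly coeff_mult sum)
  show minus: "map_poly f (- p) = - map_poly f p" for p
    by (rule poly_eqI) (simp add: coeff_map_poly)
  show "map_poly f (p - q) = map_poly f p - map_poly f q"
    using add[of p "- q"] minus[of q] by simp
  show "map_poly f (smult c p) = smult (f c) (map_poly f p)"
    by (rule poly_eqI) (simp add: coeff_map_poly)
  show "map_poly f (pCons c p) = pCons (f c) (map_poly f p)"
    by (rule poly_eqI) (simp add: coeff_map_poly coeff_pCons split: nat.split)
qed

text \<open>Over an algebraically closed field \<open>q\<close> splits into linear factors, and a
  prime ideal containing the product contains a factor. In degree zero \<open>P\<close> would
  contain a unit.\<close>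

lemma prime_linear_factor:
  fixes \<phi> :: "'k::alg_closed_field \<Rightarrow> 'b::comm_ring_1" and P :: "'b set"
  assumes hom: "\<phi> \<in> ring_hom ring_of_type_algebra ring_of_type_algebra"
    and P: "primeideal P ring_of_type_algebra"
    and "q \<noteq> 0" "poly (map_poly \<phi> q) u \<in> P"
  shows "\<exists>c. u - \<phi> c \<in> P"
  using assms(3,4)
proof (induction "Polynomial.degree q" arbitrary: q)
  case 0
  then obtain c where c: "q = [:c:]" "c \<noteq> 0" by (metis degree_eq_zeroE pCons_0_0)
  then have "\<phi> c \<in> P" using 0 by (simp add: map_poly_hom[OF hom] ring_hom_typeD[OF hom])
  then have "\<phi> (inverse c) * \<phi> c \<in> P" using primeideal_type_mult_iff[OF P] by blast
  then have "1 \<in> P" using c ring_hom_typeD(2,3)[OF hom] by (metis left_inverse)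
  then show ?case using P by (simp add: primeideal_type_iff)
next
  case (Suc n)
  obtain z where "poly q z = 0" using alg_closed_imp_poly_has_root[of q] Suc by auto
  then obtain r where r: "q = [:- z, 1:] * r" by (auto simp: poly_eq_0_iff_dvd)
  have "n = Polynomial.degree r" 
    using Suc(2) \<open>q \<noteq> 0\<close> unfolding r by (subst (asm) degree_mult_eq) auto
  have "(u - \<phi> z) * poly (map_poly \<phi> r) u \<in> P"
    using Suc r by (simp only: map_poly_hom[OF hom] Polynomial.poly_mult) (simp add: ring_hom_typeD[OF hom] map_poly_hom[OF hom])
  then consider "u - \<phi> z \<in> P" | "poly (map_poly \<phi> r) u \<in> P"
    using primeideal_type_mult_iff[OF P] by blast
  then show ?case
  proof cases
    case 2
    then show ?thesis using Suc r by (intro Suc.hyps(1)[of r]) (auto simp: \<open>n = Polynomial.degree r\<close>)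
  qed blast
qed

text \<open>An ideal maximal among those that contain \<open>P\<close> and no power of
  \<open>g\<close> is prime. The last clause says that the quotient by \<open>N\<close> becomes a
  field once \<open>g\<close> is inverted.\<close>

lemma exists_primeideal_avoiding_powers:
  fixes P :: "'b::comm_ring_1 set"
  assumes P: "ideal P ring_of_type_algebra" "\<And>k. g ^ k \<notin> P"
  shows "\<exists>N. primeideal N ring_of_type_algebra \<and> P \<subseteq> N \<and> g \<notin> N \<and>
    (\<forall>a. a \<notin> N \<longrightarrow> (\<exists>k x. g ^ k - x * a \<in> N))"
proof -
  interpret ring "ring_of_type_algebra :: 'b ring" by (rule ring_from_type_algebra)
  let ?A = "{I. ideal I ring_of_type_algebra \<and> P \<subseteq> I \<and> (\<forall>k. g ^ k \<notin> I)}"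
  have "\<exists>M\<in>?A. \<forall>I\<in>?A. M \<subseteq> I \<longrightarrow> I = M"
  proof (rule subset_Zorn_nonempty)
    fix C assume C: "C \<noteq> {}" "subset.chain ?A C"
    then have "subset.chain {I. ideal I ring_of_type_algebra} C" by (auto simp: subset_chain_def)
    from chain_Union_is_ideal[OF this] C(1) have idl: "ideal (\<Union>C) ring_of_type_algebra" by simp
    have "C \<subseteq> ?A" using C(2) by (simp add: subset_chain_def)
    then show "\<Union>C \<in> ?A" using idl C(1) by blast
  qed (use assms in auto)
  then obtain N where N: "N \<in> ?A" and max: "\<forall>I\<in>?A. N \<subseteq> I \<longrightarrow> I = N" ..
  have idl: "ideal N ring_of_type_algebra" and avoid: "g ^ k \<notin> N" for k using N by blast+
  note cl = idl[unfolded ideal_type_iff]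
  have ex: "\<exists>k x. g ^ k - x * a \<in> N" if a: "a \<notin> N" for a
  proof -
    \<comment> \<open>This is the ideal generated by \<open>N\<close> and \<open>a\<close>. It is
      strictly larger than \<open>N\<close>, so by maximality it contains a power of
      \<open>g\<close>.\<close>
    let ?J = "{y. \<exists>x. y - x * a \<in> N}"
    have "ideal ?J ring_of_type_algebra"
      unfolding ideal_type_iff
    proof (intro conjI ballI allI)
      show "0 \<in> ?J" using cl by (auto intro: exI[of _ 0])
      fix y z assume y: "y \<in> ?J"
      then obtain x where x: "y - x * a \<in> N" by blast
      have "z * (y - x * a) \<in> N" using cl x by blast
      then show "z * y \<in> ?J" by (auto intro!: exI[of _ "z * x"] simp: algebra_simps)
      assume "z \<in> ?J"
      then obtain w where "z - w * a \<in> N" by blast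
      then have "(y - x * a) + (z - w * a) \<in> N" using cl x by blast
      then show "y + z \<in> ?J" by (auto intro!: exI[of _ "x + w"] simp: algebra_simps)
    qed
    moreover have "N \<subseteq> ?J" by (auto intro: exI[of _ 0])
    moreover have "a \<in> ?J" using cl by (auto intro: exI[of _ 1])
    ultimately have J: "?J \<notin> ?A" "N \<subseteq> ?J" "ideal ?J ring_of_type_algebra"
      using max[rule_format, of ?J] a by auto
    have "P \<subseteq> ?J" using N J(2) by blast
    with J have "\<exists>k. g ^ k \<in> ?J" by blast
    then show ?thesis by simp
  qed
  have "primeideal N ring_of_type_algebra"
    unfolding primeideal_type_iff
  proof (intro conjI allI impI)
    show "1 \<notin> N" using avoid[of 0] by simp
    fix a b assume ab: "a * b \<in> N"
    show "a \<in> N \<or> b \<in> N"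
    proof (rule ccontr)
      assume "\<not> (a \<in> N \<or> b \<in> N)"
      then obtain k x l y where *: "g ^ k - x * a \<in> N" "g ^ l - y * b \<in> N" using ex by metis
      \<comment> \<open>The mixed terms cancel and leave \<open>g ^ (k + l)\<close>.\<close>
      have "g ^ l * (g ^ k - x * a) + (x * a * (g ^ l - y * b) + x * y * (a * b)) \<in> N"
        using cl * ab by blast
      then have "g ^ (k + l) \<in> N" by (simp add: algebra_simps power_add)
      then show False using avoid by blast
    qed
  qed (use idl in auto)
  moreover have "g \<notin> N" using avoid[of 1] by simp
  ultimately show ?thesis using N ex by blast
qed

text \<open>The Nullstellensatz in the form of the Jacobson property.  If no \<open>u - \<phi> c\<close> lies in \<open>N\<close>, each
  gives some \<open>v c\<close> with \<open>v c * (u - \<phi> c)\<close> congruent to a power of \<open>g\<close>.  The exponent is the same for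
  uncountably many \<open>c\<close>, whereas the algebra has countable dimension, so these \<open>v c\<close> are linearly
  dependent; clearing denominators yields a nonzero complex polynomial in \<open>u\<close> lying in \<open>N\<close>.\<close>

lemma exists_maximalideal_avoiding:
  fixes \<phi> :: "complex \<Rightarrow> 'b::comm_ring_1" and P :: "'b set"
  assumes hom: "\<phi> \<in> ring_hom ring_of_type_algebra ring_of_type_algebra"
    and S: "countable S" "generate_ring ring_of_type_algebra (range \<phi> \<union> S) = UNIV"
    and P: "ideal P ring_of_type_algebra" "\<And>k. g ^ k \<notin> P"
  shows "\<exists>M. maximalideal M ring_of_type_algebra \<and> P \<subseteq> M \<and> g \<notin> M"
proof -
  interpret vector_space "\<lambda>c x. \<phi> c * x" by (rule vector_space_ring_hom[OF hom])
  note [simp] = ring_hom_typeD[OF hom] map_poly_hom[OF hom]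
  have [simp]: "\<phi> (x - y) = \<phi> x - \<phi> y" for x y
    using ring_hom_typeD(1,5)[OF hom] by (metis add_uminus_conv_diff)
  obtain N where N: "primeideal N ring_of_type_algebra" "P \<subseteq> N" "g \<notin> N"
    and ex: "\<And>a. a \<notin> N \<Longrightarrow> \<exists>k x. g ^ k - x * a \<in> N"
    using exists_primeideal_avoiding_powers[of P g] P by blast
  have idl: "ideal N ring_of_type_algebra" using N by (simp add: primeideal_type_iff)
  have "\<exists>c. u - \<phi> c \<in> N" for u
  proof (rule ccontr)
    assume contra: "\<nexists>c. u - \<phi> c \<in> N"
    then have "\<forall>c. \<exists>k x. g ^ k - x * (u - \<phi> c) \<in> N" using ex by blast
    then obtain K v where Kv: "\<And>c. g ^ K c - v c * (u - \<phi> c) \<in> N" by metis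
    have "\<exists>k. uncountable {c. K c = k}"
    proof (rule ccontr)
      assume "\<nexists>k. uncountable {c. K c = k}"
      then have "countable (\<Union>k. {c. K c = k})" by blast
      moreover have "(\<Union>k. {c. K c = k}) = UNIV" by blast
      ultimately show False using uncountable_UNIV_complex by simp
    qed
    then obtain k where k: "uncountable {c. K c = k}" by blast
    obtain B where "countable B" "span B = UNIV" using countable_spanning_set[OF hom S] by blast
    from uncountable_imp_dependent_relation[OF this k, of v]
    obtain F w z where F: "finite F" "F \<subseteq> {c. K c = k}" "z \<in> F" "w z \<noteq> 0"
      and rel: "(\<Sum>c\<in>F. \<phi> (w c) * v c) = 0" by blast
    \<comment> \<open>Multiplying the relation by all factors \<open>u - \<phi> d\<close> leaves
      \<open>D c\<close> next to \<open>v c * (u - \<phi> c)\<close>, which is congruent to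
      \<open>g ^ k\<close>.\<close>
    define D where "D c = (\<Prod>d\<in>F - {c}. u - \<phi> d)" for c
    have "0 = (\<Sum>c\<in>F. \<phi> (w c) * v c) * (\<Prod>d\<in>F. u - \<phi> d)" using rel by simp
    also have "\<dots> = (\<Sum>c\<in>F. \<phi> (w c) * v c * ((u - \<phi> c) * D c))"
      unfolding sum_distrib_right D_def using F by (intro sum.cong refl arg_cong2[of _ _ _ _ "(*)"] prod.remove)
    \<comment> \<open>Subtracting the vanishing sum exhibits the left side as a combination of the
      elements \<open>g ^ k - v c * (u - \<phi> c)\<close> of \<open>N\<close>.\<close>
    finally have "g ^ k * (\<Sum>c\<in>F. \<phi> (w c) * D c) =
        (\<Sum>c\<in>F. \<phi> (w c) * D c * (g ^ k - v c * (u - \<phi> c)))"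
      by (simp add: sum_distrib_left algebra_simps sum.distrib sum_subtractf)
    also have "\<dots> \<in> N"
    proof (rule ideal_type_sum[OF idl])
      fix c assume "c \<in> F"
      then have "g ^ k - v c * (u - \<phi> c) \<in> N" using Kv[of c] F by auto
      then show "\<phi> (w c) * D c * (g ^ k - v c * (u - \<phi> c)) \<in> N"
        using idl unfolding ideal_type_iff by blast
    qed
    finally have "g ^ k * (\<Sum>c\<in>F. \<phi> (w c) * D c) \<in> N" .
    moreover have "g ^ k \<notin> N"
    proof (induction k)
      case 0
      then show ?case using N(1) unfolding primeideal_type_iff by simp
    next
      case (Suc k)
      then show ?case using N(3) by (simp add: primeideal_type_mult_iff[OF N(1)])
    qed
    ultimately have "(\<Sum>c\<in>F. \<phi> (w c) * D c) \<in> N"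
      using primeideal_type_mult_iff[OF N(1)] by blast
    moreover define q where "q = (\<Sum>c\<in>F. smult (w c) (\<Prod>d\<in>F - {c}. [:- d, 1:]))"
    have "poly (map_poly \<phi> (\<Prod>d\<in>G. [:- d, 1:])) u = (\<Prod>d\<in>G. u - \<phi> d)" for G
      by (induction G rule: infinite_finite_induct) (simp_all add: algebra_simps flip: one_pCons)
    moreover have "poly (map_poly \<phi> (sum f G)) u = (\<Sum>c\<in>G. poly (map_poly \<phi> (f c)) u)" for f and G :: "complex set"
      by (induction G rule: infinite_finite_induct) simp_all
    ultimately have "poly (map_poly \<phi> q) u \<in> N" by (simp add: q_def D_def)
    moreover have "q \<noteq> 0"
    proof
      assume "q = 0"
      \<comment> \<open>At the node \<open>z\<close> every summand of another index has the factor
        \<open>z - z\<close>, so only \<open>w z\<close> times a nonzero product survives, as in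
        Lagrange interpolation.\<close>
      then have "0 = poly q z" by simp
      also have "\<dots> = (\<Sum>c\<in>F. w c * (\<Prod>d\<in>F - {c}. z - d))"
        by (simp add: q_def poly_sum poly_prod)
      also have "\<dots> = (\<Sum>c\<in>{z}. w c * (\<Prod>d\<in>F - {c}. z - d))"
        using F by (intro sum.mono_neutral_right) auto
      finally show False using F by simp
    qed
    ultimately show False using prime_linear_factor[OF hom N(1)] contra by blast
  qed
  \<comment> \<open>Every residue class modulo \<open>N\<close> is now represented by a scalar, and
    nonzero scalars are units.\<close>
  then have "maximalideal N ring_of_type_algebra"
  proof (intro maximalideal_typeI)
    fix a assume "\<And>u. \<exists>c. u - \<phi> c \<in> N" "a \<notin> N"
    then obtain c where c: "a - \<phi> c \<in> N" by blast
    with \<open>a \<notin> N\<close> have "c \<noteq> 0" by auto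
    have "- \<phi> (inverse c) * (a - \<phi> c) \<in> N" using idl c unfolding ideal_type_iff by blast
    moreover have "\<phi> (inverse c) * \<phi> c = 1"
      using \<open>c \<noteq> 0\<close> ring_hom_typeD(2,3)[OF hom] by (metis left_inverse)
    ultimately show "\<exists>x. 1 - x * a \<in> N"
      by (intro exI[of _ "\<phi> (inverse c)"]) (simp add: algebra_simps)
  qed (use N in \<open>auto simp: primeideal_type_iff\<close>)
  then show ?thesis using N by blast
qed

section \<open>The Zariski topology\<close>

definition zero_locus :: "'b::comm_ring_1 set \<Rightarrow> 'b set set" where
  "zero_locus A = {M \<in> mSpec ring_of_type_algebra. A \<subseteq> M}"

lemma mSpec_primeideal:
  "M \<in> mSpec (ring_of_type_algebra :: 'b::comm_ring_1 ring) \<Longrightarrow> primeideal M ring_of_type_algebra"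
  by (simp add: mSpec_def maximalideal_type_primeideal)

lemma topspace_zariski_type: "topspace (zariski (ring_of_type_algebra :: 'b::comm_ring_1 ring)) = mSpec ring_of_type_algebra"
  by (rule topspace_zariski) (rule ring_from_type_algebra)

lemma openin_zariski_basic:
  "openin (zariski ring_of_type_algebra) {M \<in> mSpec ring_of_type_algebra. (f :: 'b::comm_ring_1) \<notin> M}"
  unfolding zariski_def by (rule topology_generated_by_Basis) auto

text \<open>The generating sets form a basis, not just a subbasis: maximal ideals are prime, so the
  sets of \<open>f\<close> and \<open>g\<close> intersect in the set of
  \<open>f * g\<close>.\<close>

lemma openin_zariski_basis:
  fixes M :: "'b::comm_ring_1 set"
  assumes "openin (zariski ring_of_type_algebra) U" "M \<in> U"
  shows "\<exists>f. f \<notin> M \<and> {N \<in> mSpec ring_of_type_algebra. f \<notin> N} \<subseteq> U"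
proof -
  from assms(1) have "generate_topology_on
      {{M \<in> mSpec ring_of_type_algebra. f \<notin> M} | f. f \<in> carrier (ring_of_type_algebra :: 'b ring)} U"
    unfolding zariski_def by (rule openin_topology_generated_by)
  then show ?thesis using assms(2)
  proof induction
    case (Int a b)
    obtain f g where f: "f \<notin> M" "{N \<in> mSpec ring_of_type_algebra. f \<notin> N} \<subseteq> a"
      and g: "g \<notin> M" "{N \<in> mSpec ring_of_type_algebra. g \<notin> N} \<subseteq> b" using Int by blast
    have "M \<in> mSpec ring_of_type_algebra"
    proof -
      have "generate_topology_on
        {{M \<in> mSpec ring_of_type_algebra. f \<notin> M} | f. f \<in> carrier (ring_of_type_algebra :: 'b ring)} a"
        by fact
      then have "openin (zariski ring_of_type_algebra) a"
        unfolding zariski_def by (simp add: openin_topology_generated_by_iff)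
      then show ?thesis using openin_subset[of _ a] Int(5) topspace_zariski_type by blast
    qed
    then have "f * g \<notin> M"
      using f(1) g(1) primeideal_type_mult_iff[OF mSpec_primeideal] by blast
    moreover have "{N \<in> mSpec ring_of_type_algebra. f * g \<notin> N} \<subseteq> a \<inter> b"
      using f(2) g(2) primeideal_type_mult_iff[OF mSpec_primeideal] by blast
    ultimately show ?case by blast
  next
    case (UN K)
    then obtain k where k: "k \<in> K" "M \<in> k" by blast
    with UN.IH[OF k] show ?case by blast
  next
    case (Basis s)
    then obtain f where "s = {M \<in> mSpec ring_of_type_algebra. f \<notin> M}" by blast
    then show ?case using Basis by (intro exI[of _ f]) simp
  qed simp
qed

lemma closedin_zero_locus: "closedin (zariski ring_of_type_algebra) (zero_locus (A :: 'b::comm_ring_1 set))"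
proof -
  have "openin (zariski ring_of_type_algebra) (\<Union>f\<in>A. {M \<in> mSpec ring_of_type_algebra. f \<notin> M})"
    by (intro openin_Union) (auto simp: openin_zariski_basic)
  moreover have "(\<Union>f\<in>A. {M \<in> mSpec ring_of_type_algebra. f \<notin> M}) = mSpec ring_of_type_algebra - zero_locus A"
    unfolding zero_locus_def by blast
  moreover have "zero_locus A \<subseteq> mSpec ring_of_type_algebra" by (auto simp: zero_locus_def)
  ultimately show ?thesis by (simp add: closedin_def topspace_zariski_type)
qed

text \<open>A maximal ideal outside \<open>W\<close> has a basic neighbourhood that misses
  \<open>W\<close>; the element \<open>f\<close> defining it lies in all members of \<open>W\<close>
  but not in this ideal. For empty \<open>W\<close>, \<open>\<Inter>W\<close> is the whole ring and
  the locus is empty too.\<close>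

lemma closedin_zariski_eq_zero_locus:
  fixes W :: "'b::comm_ring_1 set set"
  assumes W: "closedin (zariski ring_of_type_algebra) W"
  shows "zero_locus (\<Inter>W) = W"
proof
  have sub: "W \<subseteq> mSpec ring_of_type_algebra"
    using closedin_subset[OF W] by (simp add: topspace_zariski_type)
  then show "W \<subseteq> zero_locus (\<Inter>W)" unfolding zero_locus_def by blast
  show "zero_locus (\<Inter>W) \<subseteq> W"
  proof
    fix M assume M: "M \<in> zero_locus (\<Inter>W)"
    show "M \<in> W"
    proof (rule ccontr)
      assume "M \<notin> W"
      moreover have "openin (zariski ring_of_type_algebra) (mSpec ring_of_type_algebra - W)"
        using W by (simp add: closedin_def topspace_zariski_type)
      moreover have "M \<in> mSpec ring_of_type_algebra" using M by (simp add: zero_locus_def)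
      ultimately obtain f where f: "f \<notin> M" "{N \<in> mSpec ring_of_type_algebra. f \<notin> N} \<subseteq> mSpec ring_of_type_algebra - W"
        using openin_zariski_basis[of "mSpec ring_of_type_algebra - W" M] by blast
      then have "f \<in> \<Inter>W" using sub by blast
      then show False using f(1) M by (auto simp: zero_locus_def)
    qed
  qed
qed

lemma ideal_Inter_mSpec:
  assumes "Z \<subseteq> mSpec (ring_of_type_algebra :: 'b::comm_ring_1 ring)"
  shows "ideal (\<Inter>Z) (ring_of_type_algebra :: 'b ring)"
proof -
  have "ideal M ring_of_type_algebra" if "M \<in> Z" for M
    using mSpec_primeideal[of M] that assms primeideal_type_iff by blast
  then show ?thesis unfolding ideal_type_iff by blast
qed

text \<open>If \<open>a * b\<close> vanishes on \<open>Z\<close>, the loci of \<open>a\<close> and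
  \<open>b\<close> cover \<open>Z\<close>. Conversely, a cover by proper closed parts gives elements
  that vanish on one part each but not on \<open>Z\<close>, while their product vanishes on
  \<open>Z\<close>. \<open>Z\<close> may fail to be closed, as in
  \<open>irreducible_components\<close>.\<close>

lemma irreducible_in_zariski_iff:
  fixes Z :: "'b::comm_ring_1 set set"
  shows "irreducible_in (zariski ring_of_type_algebra) Z \<longleftrightarrow>
    Z \<subseteq> mSpec ring_of_type_algebra \<and> primeideal (\<Inter>Z) ring_of_type_algebra"
proof (intro iffI conjI)
  assume irr: "irreducible_in (zariski ring_of_type_algebra) Z"
  then show sub: "Z \<subseteq> mSpec ring_of_type_algebra"
    by (simp add: irreducible_in_def topspace_zariski_type)
  have ne: "Z \<noteq> {}" using irr by (simp add: irreducible_in_def)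
  have pr: "primeideal M ring_of_type_algebra" if "M \<in> Z" for M
    using mSpec_primeideal sub that by blast
  show "primeideal (\<Inter>Z) ring_of_type_algebra"
    unfolding primeideal_type_iff
  proof (intro conjI allI impI)
    show "ideal (\<Inter>Z) ring_of_type_algebra" using sub by (rule ideal_Inter_mSpec)
    obtain M where "M \<in> Z" using ne by blast
    then show "1 \<notin> \<Inter>Z" using pr[of M] primeideal_type_iff by blast
    fix a b assume ab: "a * b \<in> \<Inter>Z"
    have cl: "closedin (subtopology (zariski ring_of_type_algebra) Z) (zero_locus {c} \<inter> Z)" for c
      using closedin_zero_locus closedin_subtopology by blast
    have mem: "a \<in> M \<or> b \<in> M" if "M \<in> Z" for M
      using primeideal_type_mult_iff[OF pr[OF that]] that ab by blast
    have "Z = (zero_locus {a} \<inter> Z) \<union> (zero_locus {b} \<inter> Z)"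
      using mem sub by (auto simp: zero_locus_def)
    then have "zero_locus {a} \<inter> Z = Z \<or> zero_locus {b} \<inter> Z = Z"
      using irr cl unfolding irreducible_in_def by blast
    then show "a \<in> \<Inter>Z \<or> b \<in> \<Inter>Z" by (auto simp: zero_locus_def)
  qed
next
  assume Z: "Z \<subseteq> mSpec ring_of_type_algebra \<and> primeideal (\<Inter>Z) ring_of_type_algebra"
  have "1 \<notin> \<Inter>Z" using Z by (simp add: primeideal_type_iff)
  then have "Z \<noteq> {}" by auto
  have ex: "\<exists>f. f \<notin> \<Inter>Z \<and> (\<forall>M\<in>C. f \<in> M)"
    if C: "closedin (subtopology (zariski ring_of_type_algebra) Z) C" "C \<noteq> Z" for C
  proof -
    obtain F where F: "closedin (zariski ring_of_type_algebra) F" "C = F \<inter> Z"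
      using C(1) unfolding closedin_subtopology by blast
    obtain M where M: "M \<in> Z" "M \<notin> F" using F C by blast
    then have "M \<notin> zero_locus (\<Inter>F)" using closedin_zariski_eq_zero_locus[OF F(1)] by simp
    then have "\<not> \<Inter>F \<subseteq> M" using M Z by (auto simp: zero_locus_def)
    then obtain f where "f \<in> \<Inter>F" "f \<notin> M" by blast
    then show ?thesis using M F by blast
  qed
  show "irreducible_in (zariski ring_of_type_algebra) Z"
    unfolding irreducible_in_def
  proof (intro conjI allI impI)
    show "Z \<subseteq> topspace (zariski ring_of_type_algebra)" using Z by (simp add: topspace_zariski_type)
    show "Z \<noteq> {}" by fact
    fix C D
    assume CD: "closedin (subtopology (zariski ring_of_type_algebra) Z) C \<and>
      closedin (subtopology (zariski ring_of_type_algebra) Z) D \<and> Z = C \<union> D"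
    show "C = Z \<or> D = Z"
    proof (rule ccontr)
      assume n: "\<not> (C = Z \<or> D = Z)"
      obtain f where f: "f \<notin> \<Inter>Z" "\<forall>M\<in>C. f \<in> M" using ex[of C] CD n by blast
      obtain g where g: "g \<notin> \<Inter>Z" "\<forall>M\<in>D. g \<in> M" using ex[of D] CD n by blast
      have "f * g \<notin> \<Inter>Z" using f g Z primeideal_type_mult_iff by blast
      moreover have "f * g \<in> M" if "M \<in> Z" for M
        using that f g CD Z primeideal_type_mult_iff[OF mSpec_primeideal, of M] by blast
      ultimately show False by blast
    qed
  qed
qed

text \<open>No power of an element outside \<open>P\<close> lies in \<open>P\<close>, so the
  Jacobson property gives a maximal ideal above \<open>P\<close> that omits it. Prime ideals can
  thus be recovered from their loci.\<close>

lemma Inter_zero_locus_prime: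
  fixes \<phi> :: "complex \<Rightarrow> 'b::comm_ring_1" and P :: "'b set"
  assumes "reduced_fg_complex_algebra \<phi>" "primeideal P ring_of_type_algebra"
  shows "\<Inter>(zero_locus P) = P"
proof
  show "P \<subseteq> \<Inter>(zero_locus P)" by (auto simp: zero_locus_def)
  show "\<Inter>(zero_locus P) \<subseteq> P"
  proof (rule ccontr)
    assume "\<not> \<Inter>(zero_locus P) \<subseteq> P"
    then obtain g where g: "g \<in> \<Inter>(zero_locus P)" "g \<notin> P" by blast
    obtain S where S: "\<phi> \<in> ring_hom ring_of_type_algebra ring_of_type_algebra" "finite S"
      "generate_ring ring_of_type_algebra (range \<phi> \<union> S) = UNIV"
      using assms(1) unfolding reduced_fg_complex_algebra_def by blast
    have pw: "g ^ k \<notin> P" for k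
    proof (induction k)
      case 0
      then show ?case using assms(2) unfolding primeideal_type_iff by simp
    next
      case (Suc k)
      then show ?case using g(2) by (simp add: primeideal_type_mult_iff[OF assms(2)])
    qed
    have "ideal P ring_of_type_algebra" using assms(2) by (simp add: primeideal_type_iff)
    from exists_maximalideal_avoiding[OF S(1) countable_finite[OF S(2)] S(3) this pw]
    obtain M where "maximalideal M ring_of_type_algebra" "P \<subseteq> M" "g \<notin> M" by blast
    then show False using g(1) by (auto simp: zero_locus_def mSpec_def)
  qed
qed

lemma irreducible_in_zero_locus_prime:
  fixes \<phi> :: "complex \<Rightarrow> 'b::comm_ring_1" and P :: "'b set"
  assumes "reduced_fg_complex_algebra \<phi>" "primeideal P ring_of_type_algebra"
  shows "irreducible_in (zariski ring_of_type_algebra) (zero_locus P)"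
  unfolding irreducible_in_zariski_iff Inter_zero_locus_prime[OF assms]
  using assms(2) by (auto simp: zero_locus_def)

text \<open>The closure \<open>zero_locus (\<Inter>Z)\<close> has the same ideal as
  \<open>Z\<close>, so it is irreducible, and it stays inside the closed set \<open>S\<close>.
  Maximality makes it equal to \<open>Z\<close>.\<close>

lemma irreducible_components_closed:
  fixes S :: "'b::comm_ring_1 set set"
  assumes S: "closedin (zariski ring_of_type_algebra) S"
    and Z: "Z \<in> irreducible_components (zariski ring_of_type_algebra) S"
  shows "closedin (zariski ring_of_type_algebra) Z"
proof -
  have irr: "irreducible_in (zariski ring_of_type_algebra) Z" and sub: "Z \<subseteq> S"
    and max: "\<And>Z'. irreducible_in (zariski ring_of_type_algebra) Z' \<Longrightarrow> Z' \<subseteq> S \<Longrightarrow> Z \<subseteq> Z' \<Longrightarrow> Z' = Z"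
    using Z unfolding irreducible_components_def by blast+
  have Zm: "Z \<subseteq> mSpec ring_of_type_algebra" "primeideal (\<Inter>Z) ring_of_type_algebra"
    using irr irreducible_in_zariski_iff by blast+
  then have sup: "Z \<subseteq> zero_locus (\<Inter>Z)" unfolding zero_locus_def by blast
  then have "\<Inter>(zero_locus (\<Inter>Z)) = \<Inter>Z" unfolding zero_locus_def by blast
  then have "irreducible_in (zariski ring_of_type_algebra) (zero_locus (\<Inter>Z))"
    unfolding irreducible_in_zariski_iff using Zm by (simp add: zero_locus_def)
  moreover have "zero_locus (\<Inter>Z) \<subseteq> zero_locus (\<Inter>S)"
    using sub unfolding zero_locus_def by blast
  ultimately have "zero_locus (\<Inter>Z) = Z"
    using max sup closedin_zariski_eq_zero_locus[OF S] by blast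
  then show ?thesis using closedin_zero_locus[of "\<Inter>Z"] by simp
qed

section \<open>Prime elements and primitive polynomials\<close>

lemma Units_type: "x \<in> Units (ring_of_type_algebra :: 'a::idom ring) \<longleftrightarrow> x dvd 1"
proof
  assume "x dvd 1"
  then obtain y where "1 = x * y" by (rule dvdE)
  then show "x \<in> Units (ring_of_type_algebra :: 'a ring)"
    unfolding Units_def by (auto intro!: exI[of _ y] simp: mult.commute)
next
  assume "x \<in> Units (ring_of_type_algebra :: 'a ring)"
  then obtain y where "x * y = 1" unfolding Units_def by auto
  then show "x dvd 1" by (metis dvd_triv_left)
qed

lemma divides_mult_of_type:
  assumes "x \<noteq> 0" "y \<noteq> 0"
  shows "x divides\<^bsub>mult_of (ring_of_type_algebra :: 'a::idom ring)\<^esub> y \<longleftrightarrow> x dvd y"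
  using assms unfolding factor_def dvd_def by auto

lemma factorial_domain_division_wf:
  assumes "factorial_domain (ring_of_type_algebra :: 'a::idom ring)"
  shows "wf {(x, y :: 'a). x \<noteq> 0 \<and> y \<noteq> 0 \<and> x dvd y \<and> \<not> y dvd x}"
proof -
  interpret factorial_domain "ring_of_type_algebra :: 'a ring" by fact
  have "{(x, y :: 'a). x \<noteq> 0 \<and> y \<noteq> 0 \<and> x dvd y \<and> \<not> y dvd x} =
    {(x, y). x \<in> carrier (mult_of ring_of_type_algebra) \<and> y \<in> carrier (mult_of ring_of_type_algebra) \<and>
       properfactor (mult_of ring_of_type_algebra) x y}"
    by (auto simp: properfactor_def divides_mult_of_type)
  then show ?thesis using division_wellfounded by simp
qed

text \<open>Descend along proper nonunit divisors. The descent ends at an irreducible element, and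
  these are prime in a factorial domain.\<close>

lemma factorial_domain_exists_prime_elem:
  fixes x :: "'a::idom"
  assumes fact: "factorial_domain (ring_of_type_algebra :: 'a ring)" and "x \<noteq> 0" "\<not> x dvd 1"
  shows "\<exists>q. prime_elem q \<and> q dvd x"
proof -
  interpret factorial_domain "ring_of_type_algebra :: 'a ring" by fact
  show ?thesis
    using factorial_domain_division_wf[OF fact] assms(2,3)
  proof (induction x rule: wf_induct_rule)
    case (less x)
    show ?case
    proof (cases "\<exists>b. b \<noteq> 0 \<and> b dvd x \<and> \<not> x dvd b \<and> \<not> b dvd 1")
      case True
      then obtain b where b: "b \<noteq> 0" "b dvd x" "\<not> x dvd b" "\<not> b dvd 1" by blast
      then obtain q where "prime_elem q" "q dvd b" using less by blast
      then show ?thesis using b(2) dvd_trans by blast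
    next
      case False
      then have "Divisibility.irreducible (mult_of ring_of_type_algebra) x"
        using less(2,3) by (auto simp: Divisibility.irreducible_def Units_type properfactor_def divides_mult_of_type)
      then have "Divisibility.prime (mult_of ring_of_type_algebra) x"
        using factorial_monoid.irreducible_prime[OF factorial_monoid_axioms] less(2) by simp
      then have pr: "x dvd a * b \<Longrightarrow> x dvd a \<or> x dvd b" if "a \<noteq> 0" "b \<noteq> 0" for a b
        using that less(2) unfolding Divisibility.prime_def by (simp add: divides_mult_of_type)
      have "prime_elem x"
      proof (rule prime_elemI)
        show "x dvd a \<or> x dvd b" if "x dvd a * b" for a b
          using that pr[of a b] by (cases "a = 0 \<or> b = 0") auto
      qed (use less(2,3) in simp_all)
      then show ?thesis by (intro exI[of _ x] conjI dvd_refl)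
    qed
  qed
qed

text \<open>Induction by splitting off one prime factor at a time. No prime element divides a unit,
  so units are the base case hidden in \<open>step\<close>.\<close>

lemma factorial_domain_prime_induct [consumes 2, case_names step]:
  fixes x :: "'a::idom"
  assumes fact: "factorial_domain (ring_of_type_algebra :: 'a ring)" and "x \<noteq> 0"
    and step: "\<And>x. x \<noteq> 0 \<Longrightarrow> (\<And>q y. prime_elem q \<Longrightarrow> x = q * y \<Longrightarrow> P y) \<Longrightarrow> P x"
  shows "P x"
  using factorial_domain_division_wf[OF fact] assms(2)
proof (induction x rule: wf_induct_rule)
  case (less x)
  show ?case
  proof (rule step[OF less(2)])
    fix q y assume q: "prime_elem q" "x = q * y"
    \<comment> \<open>The cofactor is strictly smaller in the divisibility order: otherwise
      cancelling \<open>y\<close> would make \<open>q\<close> a unit.\<close>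
    have "\<not> x dvd y"
    proof
      assume "x dvd y"
      then obtain k where "y = q * y * k" using q by (auto simp: dvd_def)
      then have "y * 1 = y * (q * k)" by (simp add: algebra_simps)
      then have "1 = q * k" using less(2) q by (simp del: mult_1_right)
      then have "q dvd 1" by (metis dvd_triv_left)
      then show False using q by (simp add: prime_elem_def)
    qed
    then show "P y" using less q by (intro less(1)) auto
  qed
qed

text \<open>With \<open>q = p * c\<close>, the prime \<open>q\<close> divides \<open>p\<close> or
  \<open>c\<close>; the latter would make \<open>p\<close> a unit.\<close>

lemma prime_elem_dvd_prime_elem:
  fixes p q :: "'a::idom"
  assumes "prime_elem p" "prime_elem q" "p dvd q"
  shows "q dvd p"
proof -
  obtain c where c: "q = p * c" using assms by (auto simp: dvd_def)
  then consider "q dvd p" | "q dvd c" using assms(2) prime_elem_dvd_mult_iff[of q p c] by auto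
  then show ?thesis
  proof cases
    case 2
    then obtain d where "c = q * d" by (auto simp: dvd_def)
    then have "q = p * (q * d)" using c by simp
    then have "q * 1 = q * (p * d)" by (simp only: mult.left_commute mult_1_right)
    moreover have "q \<noteq> 0" using assms(2) unfolding prime_elem_def by blast
    ultimately have "1 = p * d" using mult_left_cancel[of q 1 "p * d"] by blast
    then have "p dvd 1" by (metis dvd_triv_left)
    then show ?thesis using assms(1) by (simp add: prime_elem_def)
  qed
qed

lemma primeideal_multiples:
  fixes p :: "'a::idom"
  assumes "prime_elem p"
  shows "primeideal {x. p dvd x} ring_of_type_algebra"
  using assms by (auto simp: primeideal_type_iff ideal_type_iff prime_elem_def)

text \<open>Splitting a prime factor off \<open>x\<close> puts the factor or the cofactor into
  \<open>Q\<close>. The process cannot end in a unit, since \<open>Q\<close> is proper.\<close>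

lemma factorial_domain_primeideal_prime_elem:
  fixes Q :: "'a::idom set"
  assumes fact: "factorial_domain (ring_of_type_algebra :: 'a ring)"
    and Q: "primeideal Q ring_of_type_algebra" and "x \<in> Q" "x \<noteq> 0"
  shows "\<exists>q\<in>Q. prime_elem q \<and> q dvd x"
  using fact assms(4,3)
proof (induction x rule: factorial_domain_prime_induct)
  case (step x)
  have "\<not> x dvd 1"
  proof
    assume "x dvd 1"
    then obtain y where "1 = x * y" by (rule dvdE)
    then show False using step(3) Q primeideal_type_mult_iff[OF Q, of x y] by (simp add: primeideal_type_iff)
  qed
  then obtain q y where q: "prime_elem q" "x = q * y"
    using factorial_domain_exists_prime_elem[OF fact step(1)] by (auto simp: dvd_def)
  then consider "q \<in> Q" | "y \<in> Q" using step(3) primeideal_type_mult_iff[OF Q] by blast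
  then show ?case
  proof cases
    case 1
    then show ?thesis using q by auto
  next
    case 2
    then show ?thesis using step(2)[OF q] q(2) by auto
  qed
qed

text \<open>Principal primes have height one: a prime element \<open>q\<close> of \<open>Q\<close>
  is a multiple of \<open>p\<close>, hence associated to \<open>p\<close>.\<close>

lemma factorial_domain_primeideal_below_prime_elem:
  fixes Q :: "'a::idom set"
  assumes fact: "factorial_domain (ring_of_type_algebra :: 'a ring)"
    and Q: "primeideal Q ring_of_type_algebra" "x \<in> Q" "x \<noteq> 0"
    and p: "prime_elem p" "Q \<subseteq> {x. p dvd x}"
  shows "Q = {x. p dvd x}"
proof
  obtain q where q: "q \<in> Q" "prime_elem q"
    using factorial_domain_primeideal_prime_elem[OF fact Q] by blast
  then have "q dvd p" using p prime_elem_dvd_prime_elem by blast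
  show "{x. p dvd x} \<subseteq> Q"
  proof
    fix y assume "y \<in> {x. p dvd x}"
    then have "q dvd y" using \<open>q dvd p\<close> dvd_trans by blast
    then obtain c where "y = q * c" by (rule dvdE)
    then show "y \<in> Q" using q primeideal_type_mult_iff[OF Q(1)] by blast
  qed
qed fact

text \<open>Modulo \<open>P\<close> the product is a nonzero constant over a domain; degrees add, so
  \<open>f\<close> is a nonzero constant modulo \<open>P\<close> as well.\<close>

lemma primeideal_mult_coeff:
  fixes f g :: "'b::comm_ring_1 poly"
  assumes P: "primeideal P ring_of_type_algebra"
    and 0: "Polynomial.coeff (f * g) 0 \<notin> P"
    and pos: "\<And>i. i > 0 \<Longrightarrow> Polynomial.coeff (f * g) i \<in> P"
  shows "Polynomial.coeff f 0 \<notin> P" "i > 0 \<Longrightarrow> Polynomial.coeff f i \<in> P"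
proof -
  have idl: "ideal P ring_of_type_algebra" using P by (simp add: primeideal_type_iff)
  have zero: "0 \<in> P" using idl by (simp add: ideal_type_iff)
  have fg: "Polynomial.coeff f 0 \<notin> P" "Polynomial.coeff g 0 \<notin> P"
    using 0 primeideal_type_mult_iff[OF P] by (auto simp: coeff_mult)
  then show "Polynomial.coeff f 0 \<notin> P" by simp
  \<comment> \<open>\<open>top h\<close> is the degree of \<open>h\<close> modulo \<open>P\<close>;
    the maximum is over a nonempty set when the constant coefficient lies outside
    \<open>P\<close>.\<close>
  define top where "top h = Max {i. Polynomial.coeff h i \<notin> P}" for h :: "'b poly"
  have fin: "finite {i. Polynomial.coeff h i \<notin> P}" for h :: "'b poly"
  proof (rule finite_subset)
    show "{i. Polynomial.coeff h i \<notin> P} \<subseteq> {..Polynomial.degree h}"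
      using zero by (auto intro: le_degree)
  qed simp
  have top: "Polynomial.coeff h (top h) \<notin> P" if "Polynomial.coeff h 0 \<notin> P" for h
    using Max_in[OF fin[of h]] that unfolding top_def by blast
  have above: "Polynomial.coeff h i \<in> P" if "i > top h" for h i
    using Max_ge[OF fin[of h], of i] that unfolding top_def by force
  let ?n = "top f + top g"
  \<comment> \<open>In every other summand one index exceeds its \<open>top\<close>, so modulo
    \<open>P\<close> the coefficient at \<open>?n\<close> is the product of the two leading
    ones.\<close>
  have eq: "Polynomial.coeff f (top f) * Polynomial.coeff g (top g) =
    Polynomial.coeff (f * g) ?n -
      (\<Sum>i\<in>{..?n} - {top f}. Polynomial.coeff f i * Polynomial.coeff g (?n - i))"
    unfolding coeff_mult by (subst sum.remove[of _ "top f"]) auto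
  have rest: "(\<Sum>i\<in>{..?n} - {top f}. Polynomial.coeff f i * Polynomial.coeff g (?n - i)) \<in> P"
  proof (rule ideal_type_sum[OF idl])
    fix i assume "i \<in> {..?n} - {top f}"
    then have "i > top f \<or> ?n - i > top g" by auto
    then show "Polynomial.coeff f i * Polynomial.coeff g (?n - i) \<in> P"
      using above primeideal_type_mult_iff[OF P] by blast
  qed
  have "?n = 0"
  proof (rule ccontr)
    assume "?n \<noteq> 0"
    then have "Polynomial.coeff (f * g) ?n \<in> P" using pos[of ?n] by simp
    from ideal_type_diff[OF idl this rest]
    have "Polynomial.coeff f (top f) * Polynomial.coeff g (top g) \<in> P" unfolding eq .
    then show False using top fg primeideal_type_mult_iff[OF P] by blast
  qed
  then show "Polynomial.coeff f i \<in> P" if "i > 0" using above that by simp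
qed

section \<open>Polynomials over \<open>R\<close> that vanish at \<open>s\<close>\<close>

lemma of_domain_simps [simp]:
  fixes a b :: "'a::idom"
  shows "of_domain (0 :: 'a) = 0" "of_domain (1 :: 'a) = 1" "of_domain (a + b) = of_domain a + of_domain b"
  "of_domain (a * b) = of_domain a * of_domain b" "of_domain (- a) = - of_domain a"
  "of_domain (a - b) = of_domain a - of_domain b" "of_domain a = of_domain b \<longleftrightarrow> a = b"
proof -
  show add: "of_domain (a + b) = of_domain a + of_domain b" for a b :: 'a
    by (simp add: of_domain_def flip: to_ac_add)
  show "of_domain (a * b) = of_domain a * of_domain b"
    by (simp add: of_domain_def flip: to_ac_mult)
  show minus: "of_domain (- b) = - of_domain b" for b :: 'a
    by (simp add: of_domain_def flip: to_ac_minus)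
  show "of_domain (a - b) = of_domain a - of_domain b"
    using add[of a "- b"] minus[of b] by simp
  show "of_domain (0 :: 'a) = 0" "of_domain (1 :: 'a) = 1"
    by (simp_all add: of_domain_def Zero_fract_def[symmetric] One_fract_def[symmetric])
  show "of_domain a = of_domain b \<longleftrightarrow> a = b"
    by (simp add: of_domain_def eq_fract)
qed

lemma of_domain_eq_0_iff [simp]: "of_domain a = 0 \<longleftrightarrow> a = 0"
  using of_domain_simps(7)[of a 0] by simp

lemma of_domain_ring_hom: "of_domain \<in> ring_hom ring_of_type_algebra ring_of_type_algebra"
  by (rule ring_hom_memI) simp_all

lemmas map_poly_of_domain [simp] = map_poly_hom[OF of_domain_ring_hom]

abbreviation eval_at :: "'a::idom fract alg_closure \<Rightarrow> 'a poly \<Rightarrow> 'a fract alg_closure" where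
  "eval_at s g \<equiv> poly (map_poly of_domain g) s"

lemma exists_poly_clear_denominators:
  fixes p :: "'a::idom fract poly"
  shows "\<exists>b g. b \<noteq> 0 \<and> Polynomial.smult (Fract b 1) p = map_poly (\<lambda>r. Fract r 1) g"
proof (induction p)
  case 0
  show ?case by (intro exI[of _ 1] exI[of _ 0]) simp
next
  case (pCons c p)
  then obtain b g where b: "b \<noteq> 0" "Polynomial.smult (Fract b 1) p = map_poly (\<lambda>r. Fract r 1) g" by blast
  obtain u v where c: "c = Fract u v" "v \<noteq> 0" by (cases c)
  have hom: "(\<lambda>r. Fract r 1) \<in> ring_hom (ring_of_type_algebra :: 'a ring) ring_of_type_algebra"
    by (rule ring_hom_memI) (simp_all add: One_fract_def)
  have "Polynomial.smult (Fract (v * b) 1) p = Polynomial.smult (Fract v 1) (Polynomial.smult (Fract b 1) p)"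
    by simp
  also have "\<dots> = map_poly (\<lambda>r. Fract r 1) (Polynomial.smult v g)"
    by (simp only: b map_poly_hom[OF hom])
  finally have "Polynomial.smult (Fract (v * b) 1) (pCons c p) = map_poly (\<lambda>r. Fract r 1) (pCons (u * b) (Polynomial.smult v g))"
    using c by (simp add: map_poly_hom[OF hom] eq_fract)
  then show ?case using b(1) c(2) by (intro exI[of _ "v * b"] exI[of _ "pCons (u * b) (Polynomial.smult v g)"]) simp
qed

lemma exists_root_poly:
  fixes s :: "'a::idom fract alg_closure"
  shows "\<exists>g. g \<noteq> 0 \<and> eval_at s g = 0"
proof -
  obtain p :: "'a fract poly" where p: "p \<noteq> 0" "poly (map_poly to_ac p) s = 0"
    using alg_closure_algebraic by blast
  obtain b g where b: "b \<noteq> 0" "Polynomial.smult (Fract b 1) p = map_poly (\<lambda>r. Fract r 1) g"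
    using exists_poly_clear_denominators by blast
  have "map_poly of_domain g = map_poly to_ac (map_poly (\<lambda>r. Fract r 1) g)"
    by (rule poly_eqI) (simp add: coeff_map_poly of_domain_def Zero_fract_def)
  also have "\<dots> = map_poly to_ac (Polynomial.smult (Fract b 1) p)" by (simp only: b)
  also have "\<dots> = Polynomial.smult (of_domain b) (map_poly to_ac p)"
    by (rule poly_eqI) (simp add: coeff_map_poly of_domain_def)
  finally have "eval_at s g = 0" using p by simp
  moreover have "g \<noteq> 0"
    using b p(1) by (auto simp: Zero_fract_def eq_fract)
  ultimately show ?thesis by blast
qed

text \<open>Gauss's lemma: a primitive polynomial of minimal degree that vanishes at \<open>s\<close> presents
  \<open>R[s]\<close> as a quotient of \<open>R[t]\<close>, not only after passing to the fraction field.\<close>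

lemma exists_primitive_presentation:
  fixes s :: "'a::idom fract alg_closure"
  assumes fact: "factorial_domain (ring_of_type_algebra :: 'a ring)"
  obtains f where "Polynomial.degree f > 0" "\<And>g. eval_at s g = 0 \<longleftrightarrow> f dvd g"
    "\<And>q. prime_elem q \<Longrightarrow> \<not> [:q:] dvd f"
proof -
  obtain h where h: "h \<noteq> 0" "eval_at s h = 0"
    and hmin: "\<And>g. g \<noteq> 0 \<Longrightarrow> eval_at s g = 0 \<Longrightarrow> Polynomial.degree h \<le> Polynomial.degree g"
    using ex_has_least_nat[of "\<lambda>g. g \<noteq> 0 \<and> eval_at s g = 0" _ Polynomial.degree] exists_root_poly[of s]
    by blast
  \<comment> \<open>Prime constants are divided out of a vanishing polynomial of minimal degree.
    This stops because the leading coefficient loses a prime factor each time.\<close>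
  have "\<exists>f. f \<noteq> 0 \<and> eval_at s f = 0 \<and> Polynomial.degree f = Polynomial.degree h \<and>
      (\<forall>q. prime_elem q \<longrightarrow> \<not> [:q:] dvd f)"
    if "c = Polynomial.lead_coeff g" "g \<noteq> 0" "eval_at s g = 0" "Polynomial.degree g = Polynomial.degree h" "c \<noteq> 0" for c g
    using fact that(5) that(1-4)
  proof (induction c arbitrary: g rule: factorial_domain_prime_induct)
    case (step c)
    show ?case
    proof (cases "\<exists>q. prime_elem q \<and> [:q:] dvd g")
      case True
      then obtain q k where q: "prime_elem q" "g = Polynomial.smult q k" by (auto simp: dvd_def)
      then have "q \<noteq> 0" by (simp add: prime_elem_def)
      have "c = q * Polynomial.lead_coeff k" using q step by simp
      moreover have "k \<noteq> 0" "eval_at s k = 0" "Polynomial.degree k = Polynomial.degree h"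
        using step q \<open>q \<noteq> 0\<close> by auto
      ultimately show ?thesis using step(2)[OF q(1)] by blast
    next
      case False
      then show ?thesis using step by blast
    qed
  qed
  from this[OF refl h refl] h obtain f where f: "f \<noteq> 0" "eval_at s f = 0"
    "Polynomial.degree f = Polynomial.degree h" and prim: "\<And>q. prime_elem q \<Longrightarrow> \<not> [:q:] dvd f" by auto
  have dvd: "f dvd g" if g: "eval_at s g = 0" for g
  proof -
    \<comment> \<open>Pseudo-division stays over \<open>R\<close> at the price of the factor
      \<open>a\<close>. The remainder vanishes at \<open>s\<close> and is zero by minimality of the
      degree.\<close>
    obtain a q where aq: "a \<noteq> 0" "Polynomial.smult a g = f * q + pseudo_mod g f"
      using pseudo_mod(1)[OF f(1), of g] by blast
    have "eval_at s (Polynomial.smult a g) = eval_at s (f * q + pseudo_mod g f)" by (simp only: aq)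
    then have "eval_at s (pseudo_mod g f) = 0" using g f by simp
    then have "pseudo_mod g f = 0"
      using pseudo_mod(2)[OF f(1), of g] hmin[of "pseudo_mod g f"] f(3) by force
    then have "Polynomial.smult a g = f * q" using aq by simp
    \<comment> \<open>The factor \<open>a\<close> is removed prime by prime: a prime factor divides
      \<open>f * q\<close> as a constant polynomial, but not \<open>f\<close> by primitivity, hence
      \<open>q\<close>.\<close>
    with fact aq(1) show ?thesis
    proof (induction a arbitrary: q rule: factorial_domain_prime_induct)
      case (step a)
      show ?case
      proof (cases "a dvd 1")
        case True
        then obtain u where "1 = a * u" by (rule dvdE)
        then have "g = Polynomial.smult u (Polynomial.smult a g)" by (simp add: mult.commute)
        also have "\<dots> = f * Polynomial.smult u q" using step by simp
        finally show ?thesis by (rule dvdI)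
      next
        case False
        then obtain p b where p: "prime_elem p" "a = p * b"
          using factorial_domain_exists_prime_elem[OF fact step(1)] by (auto simp: dvd_def)
        have "f * q = [:p:] * Polynomial.smult b g" using step(3) p(2) by (simp add: mult.commute)
        then have "[:p:] dvd f * q" by (rule dvdI)
        then have "[:p:] dvd q"
          using prim[OF p(1)] lift_prime_elem_poly[OF p(1)] by (simp add: prime_elem_dvd_mult_iff)
        then obtain k where k: "q = Polynomial.smult p k" by (auto simp: dvd_def)
        have "p \<noteq> 0" using p by (simp add: prime_elem_def)
        have "Polynomial.smult p (Polynomial.smult b g) = Polynomial.smult p (f * k)"
          using step(3) p k by simp
        then have "Polynomial.smult b g = f * k" using \<open>p \<noteq> 0\<close> smult_cancel by blast
        then show ?thesis using step(2)[OF p] by blast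
      qed
    qed
  qed
  have "eval_at s g = 0" if "f dvd g" for g
    using that f(2) by (auto simp: dvd_def)
  with dvd have iff: "eval_at s g = 0 \<longleftrightarrow> f dvd g" for g by blast
  have deg: "Polynomial.degree f > 0"
  proof (rule ccontr)
    assume "\<not> Polynomial.degree f > 0"
    then obtain c where "f = [:c:]" using degree_eq_zeroE by blast
    then show False using f by simp
  qed
  show ?thesis by (rule that[OF deg iff prim])
qed

section \<open>The image of the spectrum and the positive closure\<close>

lemma adjoinI: "eval_at s g \<in> adjoin s"
  by (auto simp: adjoin_def)

lemma adjoinE:
  assumes "x \<in> adjoin s" obtains g where "x = eval_at s g"
  using assms by (auto simp: adjoin_def)

lemma of_domain_in_adjoin: "of_domain r \<in> adjoin s"
  using adjoinI[of "[:r:]" s] by simp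

lemma cring_adjoin_ring: "cring (adjoin_ring s)"
  unfolding adjoin_ring_def
proof (rule cring_carrier_update)
  show "0 \<in> adjoin s" "1 \<in> adjoin s"
    using of_domain_in_adjoin[of 0 s] of_domain_in_adjoin[of 1 s] by simp_all
  show "- x \<in> adjoin s" if x: "x \<in> adjoin s" for x
  proof -
    obtain g where "x = eval_at s g" using x by (rule adjoinE)
    then show ?thesis using adjoinI[of "- g" s] by simp
  qed
  fix x y assume "x \<in> adjoin s" "y \<in> adjoin s"
  then obtain g h where "x = eval_at s g" "y = eval_at s h" by (metis adjoinE)
  then show "x + y \<in> adjoin s" "x * y \<in> adjoin s"
    using adjoinI[of "g + h" s] adjoinI[of "g * h" s] by simp_all
qed

lemma ideal_adjoin_ring_iff:
  "ideal I (adjoin_ring s) \<longleftrightarrow>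
    I \<subseteq> adjoin s \<and> 0 \<in> I \<and> (\<forall>a\<in>I. \<forall>b\<in>I. a + b \<in> I) \<and> (\<forall>x\<in>adjoin s. \<forall>a\<in>I. x * a \<in> I)"
  using ideal_carrier_update_iff[of "adjoin s" I] cring_adjoin_ring[of s] unfolding adjoin_ring_def by blast

lemma eval_at_mem_ideal:
  assumes I: "ideal I (adjoin_ring s)" and g: "\<And>i. of_domain (Polynomial.coeff g i) \<in> I"
  shows "eval_at s g \<in> I"
  using g
proof (induction g)
  case 0
  then show ?case using I by (simp add: ideal_adjoin_ring_iff)
next
  case (pCons c g)
  have "of_domain c \<in> I" using pCons.prems[of 0] by simp
  have "of_domain (Polynomial.coeff g i) \<in> I" for i using pCons.prems[of "Suc i"] by simp
  then have "eval_at s g \<in> I" by (rule pCons.IH)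
  moreover have "s \<in> adjoin s" using adjoinI[of "[:0, 1:]" s] by simp
  ultimately have "s * eval_at s g \<in> I" using I by (simp add: ideal_adjoin_ring_iff)
  with \<open>of_domain c \<in> I\<close> have "of_domain c + s * eval_at s g \<in> I"
    using I by (simp add: ideal_adjoin_ring_iff)
  then show ?case by simp
qed

text \<open>An element of \<open>R[s]\<close> in the fraction field is written as
  \<open>a / b\<close>; clearing the denominator turns membership in \<open>R\<close> into
  divisibility.\<close>

lemma mem_positive_closure_iff:
  fixes s :: "'a::idom fract alg_closure"
  shows "s \<in> positive_closure \<longleftrightarrow>
    (\<forall>a b g. b \<noteq> 0 \<longrightarrow> of_domain b * eval_at s g = of_domain a \<longrightarrow> b dvd a)"
proof
  assume s: "s \<in> positive_closure"
  show "\<forall>a b g. b \<noteq> 0 \<longrightarrow> of_domain b * eval_at s g = of_domain a \<longrightarrow> b dvd a"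
  proof (intro allI impI)
    fix a b g assume b: "b \<noteq> 0" "of_domain b * eval_at s g = of_domain a"
    have "eval_at s g = of_domain a / of_domain b" using b by (simp add: field_simps flip: b(2))
    also have "\<dots> = to_ac (Fract a 1 / Fract b 1)" by (simp only: of_domain_def to_ac_divide)
    finally have "eval_at s g \<in> adjoin s \<inter> range to_ac" using adjoinI by blast
    then obtain r where "eval_at s g = of_domain r" using s unfolding positive_closure_def by blast
    then have "of_domain (b * r) = of_domain a" using b(2) by simp
    then have "a = b * r" by (rule of_domain_simps(7)[THEN iffD1, symmetric])
    then show "b dvd a" by (rule dvdI)
  qed
next
  assume R: "\<forall>a b g. b \<noteq> 0 \<longrightarrow> of_domain b * eval_at s g = of_domain a \<longrightarrow> b dvd a"
  have "x \<in> range of_domain" if x: "x \<in> adjoin s" "x \<in> range to_ac" for x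
  proof -
    obtain g where g: "x = eval_at s g" using x(1) by (rule adjoinE)
    obtain y where y: "x = to_ac y" using x(2) by blast
    obtain a b where ab: "y = Fract a b" "b \<noteq> 0" by (cases y)
    have "to_ac (Fract b 1) * to_ac (Fract a b) = to_ac (Fract a 1)"
      using ab(2) by (subst to_ac_mult[symmetric]) (simp add: eq_fract del: to_ac_mult)
    then have eq: "of_domain b * eval_at s g = of_domain a"
      using g y ab(1) by (simp add: of_domain_def[of a] of_domain_def[of b])
    then have "b dvd a" using R ab(2) by blast
    then obtain r where "a = b * r" by (rule dvdE)
    then have "of_domain b * x = of_domain b * of_domain r" using eq g by simp
    then have "x = of_domain r" using ab(2) by simp
    then show ?thesis by blast
  qed
  moreover have "range of_domain \<subseteq> adjoin s \<inter> range to_ac"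
    using of_domain_in_adjoin by (auto simp: of_domain_def)
  ultimately show "s \<in> positive_closure" unfolding positive_closure_def by blast
qed

text \<open>If \<open>R[s] = R[t]/(f)\<close>, the fibre of \<open>R[s]\<close> over a prime of \<open>R\<close> degenerates precisely when
  \<open>f\<close> reduces to a nonzero constant; \<open>tail_coeffs f\<close> generates the ideal that detects this.\<close>

definition tail_coeffs :: "'a::zero poly \<Rightarrow> 'a set" where
  "tail_coeffs f = {Polynomial.coeff f i | i. i > 0}"

lemma tail_coeffs_subset_iff: "tail_coeffs f \<subseteq> A \<longleftrightarrow> (\<forall>i>0. Polynomial.coeff f i \<in> A)"
  by (auto simp: tail_coeffs_def)

text \<open>The primes occurring in reduced denominators of elements of \<open>R[s]\<close> in the
  fraction field are exactly those modulo which \<open>f\<close> becomes constant.\<close>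

lemma positive_closure_iff_tail_coeffs:
  fixes s :: "'a::idom fract alg_closure"
  assumes fact: "factorial_domain (ring_of_type_algebra :: 'a ring)"
    and f: "\<And>g. eval_at s g = 0 \<longleftrightarrow> f dvd g" "\<And>q. prime_elem q \<Longrightarrow> \<not> [:q:] dvd f"
  shows "s \<in> positive_closure \<longleftrightarrow> (\<forall>q. prime_elem q \<longrightarrow> \<not> tail_coeffs f \<subseteq> {x. q dvd x})"
proof
  assume s: "s \<in> positive_closure"
  show "\<forall>q. prime_elem q \<longrightarrow> \<not> tail_coeffs f \<subseteq> {x. q dvd x}"
  proof (intro allI impI notI)
    fix q assume q: "prime_elem q" and "tail_coeffs f \<subseteq> {x. q dvd x}"
    then have dvd: "q dvd Polynomial.coeff f i" if "i > 0" for i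
      using that by (simp add: tail_coeffs_subset_iff)
    obtain c h where h: "f = pCons c h" by (cases f)
    have "[:q:] dvd h" using dvd[of "Suc i" for i] h by (simp add: const_poly_dvd_iff)
    then obtain k where k: "h = Polynomial.smult q k" by (auto simp: dvd_def)
    have "eval_at s f = 0" using f(1) by simp
    \<comment> \<open>With \<open>f = c + q t k\<close>, vanishing at \<open>s\<close> makes
      \<open>c / q = - s k(s)\<close> an element of \<open>R[s]\<close> in the fraction
      field.\<close>
    then have "of_domain q * eval_at s (pCons 0 (- k)) = of_domain c"
      using h k by (simp add: algebra_simps add_eq_0_iff2)
    moreover have "q \<noteq> 0" using q by (simp add: prime_elem_def)
    ultimately have "q dvd c" using s unfolding mem_positive_closure_iff by blast
    then have "q dvd Polynomial.coeff f i" for i using dvd[of i] h by (cases i) auto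
    then show False using f(2)[OF q] by (simp add: const_poly_dvd_iff)
  qed
next
  assume R: "\<forall>q. prime_elem q \<longrightarrow> \<not> tail_coeffs f \<subseteq> {x. q dvd x}"
  have "b dvd a" if "b \<noteq> 0" "of_domain b * eval_at s g = of_domain a" for a b g
    using fact that
  proof (induction b arbitrary: a rule: factorial_domain_prime_induct)
    case (step b)
    show ?case
    proof (cases "b dvd 1")
      case False
      then obtain q y where q: "prime_elem q" "b = q * y"
        using factorial_domain_exists_prime_elem[OF fact step(1)] by (auto simp: dvd_def)
      have "eval_at s ([:a:] - Polynomial.smult b g) = 0" using step(3) by simp
      then have "f dvd [:a:] - Polynomial.smult b g" by (simp only: f(1))
      then obtain h where h: "[:a:] - Polynomial.smult b g = f * h" by (rule dvdE)
      \<comment> \<open>Modulo the prime factor \<open>q\<close> of \<open>b\<close>,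
        \<open>f * h\<close> is the constant \<open>a\<close>. If that were nonzero,
        \<open>f\<close> would be constant modulo \<open>q\<close>.\<close>
      have "q dvd a"
      proof (rule ccontr)
        assume "\<not> q dvd a"
        have co: "Polynomial.coeff (f * h) i = Polynomial.coeff [:a:] i - q * (y * Polynomial.coeff g i)" for i
          using q(2) by (simp flip: h add: mult.assoc)
        have "Polynomial.coeff (f * h) 0 \<notin> {x. q dvd x}"
          using \<open>\<not> q dvd a\<close> unfolding co by (simp add: dvd_diff_left_iff)
        moreover have "Polynomial.coeff (f * h) i \<in> {x. q dvd x}" if "i > 0" for i
          using that unfolding co by (cases i) simp_all
        ultimately have "tail_coeffs f \<subseteq> {x. q dvd x}"
          using primeideal_mult_coeff(2)[OF primeideal_multiples[OF q(1)], of f h]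
          unfolding tail_coeffs_subset_iff by blast
        then show False using R q(1) by blast
      qed
      then obtain a' where a': "a = q * a'" by (rule dvdE)
      have "of_domain q * (of_domain y * eval_at s g) = of_domain q * of_domain a'"
        using step(3) a' q(2) by (simp add: mult.assoc)
      moreover have "q \<noteq> 0" using q(1) by (simp add: prime_elem_def)
      ultimately have "of_domain y * eval_at s g = of_domain a'" by simp
      then have "y dvd a'" by (rule step(2)[OF q])
      then show ?thesis using q a' by (simp add: mult_dvd_mono)
    qed (use dvd_trans one_dvd in blast)
  qed
  then show "s \<in> positive_closure" unfolding mem_positive_closure_iff by blast
qed

text \<open>\<open>M\<close> is in the image exactly when its extension to \<open>R[s]\<close> omits
  1. As \<open>R[s] = R[t]/(f)\<close>, the extension contains 1 exactly when \<open>f\<close>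
  divides \<open>g - 1\<close> for some \<open>g\<close> with coefficients in \<open>M\<close>, that
  is, when \<open>f\<close> is a nonzero constant modulo \<open>M\<close>.\<close>

lemma mem_image_mSpec_map_iff:
  fixes s :: "'a::idom fract alg_closure"
  assumes f: "\<And>g. eval_at s g = 0 \<longleftrightarrow> f dvd g"
    and M: "M \<in> mSpec (ring_of_type_algebra :: 'a ring)"
  shows "M \<in> mSpec_map ring_of_type_algebra of_domain ` mSpec (adjoin_ring s) \<longleftrightarrow>
    (tail_coeffs f \<subseteq> M \<longrightarrow> Polynomial.coeff f 0 \<in> M)"
proof
  interpret A: cring "adjoin_ring s" by (rule cring_adjoin_ring)
  have one: "\<one>\<^bsub>adjoin_ring s\<^esub> = 1" by (simp add: adjoin_ring_def)
  have pM: "primeideal M ring_of_type_algebra" using M by (rule mSpec_primeideal)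
  then have idM: "ideal M ring_of_type_algebra" by (simp add: primeideal_type_iff)
  {
    assume "M \<in> mSpec_map ring_of_type_algebra of_domain ` mSpec (adjoin_ring s)"
    then obtain N where N: "maximalideal N (adjoin_ring s)" "M = {r. of_domain r \<in> N}"
      by (auto simp: mSpec_def mSpec_map_def)
    then have idN: "ideal N (adjoin_ring s)" by (simp add: maximalideal_def)
    show "tail_coeffs f \<subseteq> M \<longrightarrow> Polynomial.coeff f 0 \<in> M"
    proof
      assume t: "tail_coeffs f \<subseteq> M"
      obtain c h where h: "f = pCons c h" by (cases f)
      \<comment> \<open>With \<open>f = c + t h\<close>, the coefficients of \<open>t h\<close> lie
        in \<open>M\<close>, so vanishing at \<open>s\<close> forces \<open>c = - s h(s)\<close>
        into \<open>N\<close>.\<close>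
      have "of_domain (Polynomial.coeff (pCons 0 h) i) \<in> N" for i
      proof (cases i)
        case 0
        then show ?thesis using idN by (simp add: ideal_adjoin_ring_iff)
      next
        case (Suc j)
        have "Polynomial.coeff f i \<in> M" using t Suc by (simp add: tail_coeffs_subset_iff)
        then show ?thesis using h N(2) Suc by simp
      qed
      then have "eval_at s (pCons 0 h) \<in> N" by (rule eval_at_mem_ideal[OF idN])
      moreover have "of_domain (- 1) \<in> adjoin s" by (rule of_domain_in_adjoin)
      ultimately have "of_domain (- 1) * eval_at s (pCons 0 h) \<in> N"
        using idN unfolding ideal_adjoin_ring_iff by blast
      moreover have "of_domain c + s * eval_at s h = 0" using f[of f] h by simp
      then have "of_domain c = of_domain (- 1) * eval_at s (pCons 0 h)"
        by (simp add: add_eq_0_iff2)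
      ultimately have "of_domain c \<in> N" by (simp only:)
      then show "Polynomial.coeff f 0 \<in> M" using N(2) h by simp
    qed
  }
  {
    assume imp: "tail_coeffs f \<subseteq> M \<longrightarrow> Polynomial.coeff f 0 \<in> M"
    \<comment> \<open>The extension of \<open>M\<close> to \<open>R[s]\<close>.\<close>
    define J where "J = eval_at s ` {g. \<forall>i. Polynomial.coeff g i \<in> M}"
    have J: "eval_at s g \<in> J" if "\<And>i. Polynomial.coeff g i \<in> M" for g
      using that unfolding J_def by blast
    have JE: "\<exists>g. x = eval_at s g \<and> (\<forall>i. Polynomial.coeff g i \<in> M)" if "x \<in> J" for x
      using that unfolding J_def by blast
    have "ideal J (adjoin_ring s)"
      unfolding ideal_adjoin_ring_iff
    proof (intro conjI ballI)
      show "J \<subseteq> adjoin s" using JE adjoinI by blast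
      show "0 \<in> J" using J[of 0] idM by (simp add: ideal_type_iff)
    next
      fix a b assume "a \<in> J" "b \<in> J"
      then obtain g h where "a = eval_at s g" "b = eval_at s h"
        "\<And>i. Polynomial.coeff g i \<in> M" "\<And>i. Polynomial.coeff h i \<in> M" using JE by metis
      then show "a + b \<in> J" using J[of "g + h"] idM by (simp add: ideal_type_iff)
    next
      fix x a assume "x \<in> adjoin s" "a \<in> J"
      then obtain h g where *: "x = eval_at s h" "a = eval_at s g" "\<And>i. Polynomial.coeff g i \<in> M"
        using JE by (metis adjoinE)
      have "Polynomial.coeff (h * g) i \<in> M" for i
        unfolding coeff_mult using *(3) idM by (intro ideal_type_sum[OF idM]) (simp add: ideal_type_iff)
      then show "x * a \<in> J" using J[of "h * g"] *(1,2) by simp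
    qed
    moreover have "1 \<notin> J"
    proof
      assume "1 \<in> J"
      then obtain g where g: "1 = eval_at s g" "\<And>i. Polynomial.coeff g i \<in> M" using JE by blast
      then have "eval_at s (g - 1) = 0" by simp
      then have "f dvd g - 1" by (simp only: f)
      then obtain h where h: "g - 1 = f * h" by (rule dvdE)
      \<comment> \<open>Modulo \<open>M\<close>, \<open>f * h\<close> is the constant -1, so
        \<open>f\<close> is a nonzero constant there, against \<open>imp\<close>.\<close>
      have "Polynomial.coeff (f * h) 0 \<notin> M"
      proof
        assume "Polynomial.coeff (f * h) 0 \<in> M"
        then have "Polynomial.coeff g 0 - Polynomial.coeff (f * h) 0 \<in> M"
          using g(2) ideal_type_diff[OF idM] by blast
        then have "1 \<in> M" by (simp flip: h)
        then show False using pM by (simp add: primeideal_type_iff)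
      qed
      moreover have "Polynomial.coeff (f * h) i \<in> M" if "i > 0" for i
        using g(2)[of i] that by (simp flip: h)
      ultimately show False
        using primeideal_mult_coeff[OF pM, of f h] imp unfolding tail_coeffs_subset_iff by blast
    qed
    ultimately obtain N where N: "maximalideal N (adjoin_ring s)" "J \<subseteq> N"
      using A.exists_maximalideal_containing[of J] one by auto
    then have idN: "ideal N (adjoin_ring s)" by (simp add: maximalideal_def)
    let ?C = "{r. of_domain r \<in> N}"
    have "1 \<notin> N"
      using ideal.one_imp_carrier[OF idN] maximalideal.I_notcarr[OF N(1)] one by auto
    then have "1 \<notin> ?C" by simp
    have "ideal ?C ring_of_type_algebra"
      unfolding ideal_type_iff using idN of_domain_in_adjoin[of _ s] by (simp add: ideal_adjoin_ring_iff)
    moreover have "M \<subseteq> ?C"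
    proof
      fix r assume "r \<in> M"
      then have "eval_at s [:r:] \<in> J"
        using idM by (intro J) (simp add: ideal_type_iff coeff_pCons split: nat.split)
      then show "r \<in> ?C" using N(2) by auto
    qed
    \<comment> \<open>The contraction of \<open>N\<close> is proper and contains the maximal ideal
      \<open>M\<close>.\<close>
    ultimately have "?C = M \<or> ?C = UNIV"
      using maximalideal.I_maximal[of M ring_of_type_algebra ?C] M by (simp add: mSpec_def)
    then have "?C = M" using \<open>1 \<notin> ?C\<close> by blast
    then show "M \<in> mSpec_map ring_of_type_algebra of_domain ` mSpec (adjoin_ring s)"
      using N(1) by (auto simp: mSpec_def mSpec_map_def intro!: image_eqI[of _ _ N])
  }
qed

section \<open>Codimension in the factorial case\<close>

lemma two_le_codimension:
  fixes \<phi> :: "complex \<Rightarrow> 'a::idom" and Z :: "'a set set"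
  assumes fg: "reduced_fg_complex_algebra \<phi>"
    and fact: "factorial_domain (ring_of_type_algebra :: 'a ring)"
    and Z: "closedin (zariski ring_of_type_algebra) Z" "irreducible_in (zariski ring_of_type_algebra) Z"
    and nonzero: "\<not> \<Inter>Z \<subseteq> {0}"
    and no_prime: "\<And>q. prime_elem q \<Longrightarrow> \<not> \<Inter>Z \<subseteq> {x. q dvd x}"
  shows "2 \<le> codimension (zariski ring_of_type_algebra) Z"
proof -
  have pZ: "primeideal (\<Inter>Z) ring_of_type_algebra" using Z(2) by (simp add: irreducible_in_zariski_iff)
  obtain q where q: "q \<in> \<Inter>Z" "prime_elem q"
    using factorial_domain_primeideal_prime_elem[OF fact pZ] nonzero by blast
  let ?P = "{x. q dvd x}"
  have pP: "primeideal ?P ring_of_type_algebra" by (rule primeideal_multiples[OF q(2)])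
  have p0: "primeideal {0 :: 'a} ring_of_type_algebra" by (simp add: primeideal_type_iff ideal_type_iff)
  have "?P \<subseteq> \<Inter>Z"
  proof
    fix x assume "x \<in> ?P"
    then have "q dvd x" by simp
    then obtain k where "x = q * k" by (rule dvdE)
    then show "x \<in> \<Inter>Z" using q(1) primeideal_type_mult_iff[OF pZ] by blast
  qed
  then have "zero_locus (\<Inter>Z) \<subseteq> zero_locus ?P" unfolding zero_locus_def by blast
  \<comment> \<open>Equality would give \<open>\<Inter>Z = ?P\<close> by the Jacobson property,
    which \<open>no_prime\<close> excludes.\<close>
  then have 1: "Z \<subset> zero_locus ?P"
    using closedin_zariski_eq_zero_locus[OF Z(1)] Inter_zero_locus_prime[OF fg pP] no_prime[OF q(2)] by auto
  have "zero_locus ?P \<noteq> zero_locus {0}"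
  proof
    assume "zero_locus ?P = zero_locus {0}"
    then have "\<Inter>(zero_locus ?P) = \<Inter>(zero_locus {0})" by (rule arg_cong)
    then have "?P = {0}" unfolding Inter_zero_locus_prime[OF fg pP] Inter_zero_locus_prime[OF fg p0] .
    moreover have "q \<in> ?P" by simp
    ultimately have "q = 0" by (metis singletonD)
    then show False using q(2) by (simp add: prime_elem_def)
  qed
  moreover have "zero_locus ?P \<subseteq> zero_locus {0}" by (auto simp: zero_locus_def)
  ultimately have 2: "zero_locus ?P \<subset> zero_locus {0}" by blast
  \<comment> \<open>The chain from \<open>Z\<close> through the locus of \<open>q\<close> to the
    whole spectrum, continued constantly beyond index 2.\<close>
  define W where "W i = (if i = 0 then Z else if i = 1 then zero_locus ?P else zero_locus {0})" for i :: nat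
  have "closedin (zariski ring_of_type_algebra) (W i) \<and> irreducible_in (zariski ring_of_type_algebra) (W i)" for i
    unfolding W_def
    using Z irreducible_in_zero_locus_prime[OF fg pP] irreducible_in_zero_locus_prime[OF fg p0]
    by (simp add: closedin_zero_locus)
  moreover have "W i \<subset> W (Suc i)" if "i < 2" for i
    using that 1 2 unfolding W_def by (cases i) auto
  moreover have "W 0 = Z" by (simp add: W_def)
  ultimately have "2 \<in> {n. \<exists>W. W 0 = Z \<and>
      (\<forall>i\<le>n. closedin (zariski ring_of_type_algebra) (W i) \<and> irreducible_in (zariski ring_of_type_algebra) (W i)) \<and>
      (\<forall>i<n. W i \<subset> W (Suc i))}"
    by (intro CollectI exI[of _ W]) simp
  then have "enat 2 \<le> codimension (zariski ring_of_type_algebra) Z"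
    unfolding codimension_def by (rule SUP_upper)
  then show ?thesis by (simp add: numeral_eq_enat)
qed

text \<open>A chain of length two from this locus would give a nonzero prime ideal strictly inside
  the multiples of \<open>q\<close>, against height one.\<close>

lemma codimension_prime_divisor_less:
  fixes \<phi> :: "complex \<Rightarrow> 'a::idom"
  assumes fg: "reduced_fg_complex_algebra \<phi>"
    and fact: "factorial_domain (ring_of_type_algebra :: 'a ring)" and q: "prime_elem (q :: 'a)"
  shows "codimension (zariski ring_of_type_algebra) (zero_locus {x. q dvd x}) < 2"
proof -
  have pP: "primeideal {x. q dvd x} ring_of_type_algebra" by (rule primeideal_multiples[OF q])
  \<comment> \<open>Closed sets are the zero loci of their ideals, so strict inclusions reverse to
    strict inclusions.\<close>
  have strict: "\<Inter>W' \<subset> \<Inter>W"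
    if "closedin (zariski ring_of_type_algebra) W" "closedin (zariski ring_of_type_algebra) W'" "W \<subset> W'"
    for W W' :: "'a set set"
  proof -
    have "\<Inter>W \<noteq> \<Inter>W'" using that closedin_zariski_eq_zero_locus by (metis psubset_eq)
    then show ?thesis using that(3) by blast
  qed
  have "n \<le> 1"
    if W: "W 0 = zero_locus {x. q dvd x}" "\<forall>i<n. W i \<subset> W (Suc i)"
      "\<forall>i\<le>n. closedin (zariski ring_of_type_algebra) (W i) \<and> irreducible_in (zariski ring_of_type_algebra) (W i)"
    for n and W :: "nat \<Rightarrow> 'a set set"
  proof (rule ccontr)
    assume "\<not> n \<le> 1"
    then have sub: "W 0 \<subset> W 1" "W 1 \<subset> W 2"
      and cl: "closedin (zariski ring_of_type_algebra) (W 0)" "closedin (zariski ring_of_type_algebra) (W 1)"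
        "closedin (zariski ring_of_type_algebra) (W 2)"
      and irr: "irreducible_in (zariski ring_of_type_algebra) (W 1)" "irreducible_in (zariski ring_of_type_algebra) (W 2)"
      using W(2)[rule_format, of 0] W(2)[rule_format, of 1] W(3)[rule_format, of 0]
        W(3)[rule_format, of 1] W(3)[rule_format, of 2] by (simp_all add: numeral_2_eq_2)
    have ss: "\<Inter>(W 1) \<subset> \<Inter>(W 0)" "\<Inter>(W 2) \<subset> \<Inter>(W 1)"
      by (rule strict[OF cl(1,2) sub(1)], rule strict[OF cl(2,3) sub(2)])
    have p: "primeideal (\<Inter>(W 1)) ring_of_type_algebra" "primeideal (\<Inter>(W 2)) ring_of_type_algebra"
      using irr by (simp_all add: irreducible_in_zariski_iff)
    have "0 \<in> \<Inter>(W 2)" using p(2) by (simp add: primeideal_type_iff ideal_type_iff)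
    then obtain x where x: "x \<in> \<Inter>(W 1)" "x \<noteq> 0" using ss(2) by blast
    have W0: "\<Inter>(W 0) = {x. q dvd x}" unfolding W(1) by (rule Inter_zero_locus_prime[OF fg pP])
    then have "\<Inter>(W 1) \<subseteq> {x. q dvd x}" using ss(1) by simp
    then have "\<Inter>(W 1) = \<Inter>(W 0)"
      unfolding W0 by (rule factorial_domain_primeideal_below_prime_elem[OF fact p(1) x q])
    then show False using ss(1) by blast
  qed
  then have "codimension (zariski ring_of_type_algebra) (zero_locus {x. q dvd x}) \<le> enat 1"
    unfolding codimension_def by (intro SUP_least) auto
  then show ?thesis by (rule le_less_trans) (simp add: numeral_eq_enat)
qed

theorem theorem2:
  fixes \<phi> :: "complex \<Rightarrow> 'a::idom"
    and s :: "'a fract alg_closure"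
  assumes "reduced_fg_complex_algebra \<phi>"
    and "factorial_domain (ring_of_type_algebra :: 'a ring)"
  shows "s \<in> positive_closure \<longleftrightarrow>
    surjective_up_to_codim_two (zariski (adjoin_ring s)) (zariski (ring_of_type_algebra :: 'a ring))
      (mSpec_map ring_of_type_algebra of_domain)"
proof -
  note fg = assms(1) and fact = assms(2)
  let ?T = "zariski (ring_of_type_algebra :: 'a ring)"
  obtain f where f: "Polynomial.degree f > 0" "\<And>g. eval_at s g = 0 \<longleftrightarrow> f dvd g"
    "\<And>q. prime_elem q \<Longrightarrow> \<not> [:q:] dvd f"
    using exists_primitive_presentation[OF fact, of s] by blast
  define U where "U = topspace ?T - mSpec_map ring_of_type_algebra of_domain ` topspace (zariski (adjoin_ring s))"
  define S where "S = Abstract_Topology.closure_of ?T U"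
  have U: "U = {M \<in> mSpec ring_of_type_algebra. tail_coeffs f \<subseteq> M \<and> Polynomial.coeff f 0 \<notin> M}"
    unfolding U_def topspace_zariski_type topspace_zariski[OF cring.axioms(1)[OF cring_adjoin_ring]]
    using mem_image_mSpec_map_iff[of s f] f(2) by blast
  \<comment> \<open>As \<open>f\<close> has positive degree, its leading coefficient is a nonzero
    tail coefficient; hence the ideal of every component of \<open>S\<close> is nonzero.\<close>
  have lead: "Polynomial.lead_coeff f \<in> tail_coeffs f" "Polynomial.lead_coeff f \<noteq> 0"
    using f(1) by (auto simp: tail_coeffs_def)
  have SV: "S \<subseteq> zero_locus (tail_coeffs f)"
    unfolding S_def by (rule closure_of_minimal) (auto simp: U zero_locus_def closedin_zero_locus[unfolded zero_locus_def])
  have Scl: "closedin ?T S" unfolding S_def by simp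
  have tail: "tail_coeffs f \<subseteq> \<Inter>Z" if "Z \<subseteq> S" for Z
    using that SV unfolding zero_locus_def by blast
  have surj: "surjective_up_to_codim_two (zariski (adjoin_ring s)) ?T (mSpec_map ring_of_type_algebra of_domain)
      \<longleftrightarrow> (\<forall>Z\<in>irreducible_components ?T S. 2 \<le> codimension ?T Z)"
    unfolding surjective_up_to_codim_two_def S_def U_def ..
  have pc: "s \<in> positive_closure \<longleftrightarrow> (\<forall>q. prime_elem q \<longrightarrow> \<not> tail_coeffs f \<subseteq> {x. q dvd x})"
    by (rule positive_closure_iff_tail_coeffs[OF fact f(2,3)])
  show ?thesis
    unfolding pc surj
  proof (intro iffI ballI)
    fix Z assume R: "\<forall>q. prime_elem q \<longrightarrow> \<not> tail_coeffs f \<subseteq> {x. q dvd x}"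
      and Z: "Z \<in> irreducible_components ?T S"
    have sub: "tail_coeffs f \<subseteq> \<Inter>Z" and irr: "irreducible_in ?T Z"
      using Z tail unfolding irreducible_components_def by blast+
    show "2 \<le> codimension ?T Z"
    proof (rule two_le_codimension[OF fg fact irreducible_components_closed[OF Scl Z] irr])
      show "\<not> \<Inter>Z \<subseteq> {0}" using sub lead by blast
      show "\<not> \<Inter>Z \<subseteq> {x. q dvd x}" if "prime_elem q" for q using R that sub by blast
    qed
  next
    assume R: "\<forall>Z\<in>irreducible_components ?T S. 2 \<le> codimension ?T Z"
    show "\<forall>q. prime_elem q \<longrightarrow> \<not> tail_coeffs f \<subseteq> {x. q dvd x}"
    proof (intro allI impI notI)
      fix q assume q: "prime_elem q" and dvd: "tail_coeffs f \<subseteq> {x. q dvd x}"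
      let ?P = "{x. q dvd x}"
      have pP: "primeideal ?P ring_of_type_algebra" by (rule primeideal_multiples[OF q])
      have irr: "irreducible_in ?T (zero_locus ?P)" by (rule irreducible_in_zero_locus_prime[OF fg pP])
      have c0: "\<not> q dvd Polynomial.coeff f 0"
      proof
        assume "q dvd Polynomial.coeff f 0"
        then have "q dvd Polynomial.coeff f i" for i
          using dvd by (cases "i = 0") (auto simp: tail_coeffs_subset_iff)
        then show False using f(3)[OF q] by (simp add: const_poly_dvd_iff)
      qed
      \<comment> \<open>The part of the locus of \<open>q\<close> where the constant coefficient of
        \<open>f\<close> does not vanish lies in \<open>U\<close> and is dense in the locus: for a
        basic neighbourhood given by \<open>g\<close>, the product of \<open>g\<close> with that
        coefficient is not in \<open>?P\<close>, so some \<open>N\<close> above \<open>?P\<close>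
        omits it.\<close>
      have "zero_locus ?P \<subseteq> S"
      proof
        fix M assume M: "M \<in> zero_locus ?P"
        show "M \<in> S"
        proof (rule ccontr)
          assume "M \<notin> S"
          moreover have "openin ?T (mSpec ring_of_type_algebra - S)"
            using Scl by (simp add: closedin_def topspace_zariski_type)
          ultimately obtain g where g: "g \<notin> M" "{N \<in> mSpec ring_of_type_algebra. g \<notin> N} \<subseteq> mSpec ring_of_type_algebra - S"
            using openin_zariski_basis[of "mSpec ring_of_type_algebra - S" M] M
            unfolding zero_locus_def by blast
          have "g \<notin> ?P" using g(1) M by (auto simp: zero_locus_def)
          then have "g * Polynomial.coeff f 0 \<notin> ?P" using c0 primeideal_type_mult_iff[OF pP] by blast
          then obtain N where N: "N \<in> zero_locus ?P" "g * Polynomial.coeff f 0 \<notin> N"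
            using Inter_zero_locus_prime[OF fg pP] by blast
          then have Nm: "N \<in> mSpec ring_of_type_algebra" "?P \<subseteq> N" by (auto simp: zero_locus_def)
          have "g \<notin> N" "Polynomial.coeff f 0 \<notin> N"
            using N(2) primeideal_type_mult_iff[OF mSpec_primeideal[OF Nm(1)]] by blast+
          then have "N \<in> U" using Nm dvd unfolding U by blast
          then have "N \<in> S"
            using closure_of_subset[of U ?T] unfolding S_def U_def by blast
          then show False using g(2) Nm(1) \<open>g \<notin> N\<close> by blast
        qed
      qed
      \<comment> \<open>A larger irreducible set in \<open>S\<close> has a nonzero prime ideal
        inside \<open>?P\<close>, which equals \<open>?P\<close> by height one.\<close>
      moreover have "Z = zero_locus ?P" if Z: "irreducible_in ?T Z" "Z \<subseteq> S" "zero_locus ?P \<subseteq> Z" for Z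
      proof -
        have pZ: "primeideal (\<Inter>Z) ring_of_type_algebra" "Z \<subseteq> mSpec ring_of_type_algebra"
          using Z(1) by (simp_all add: irreducible_in_zariski_iff)
        have "\<Inter>Z \<subseteq> ?P" using Z(3) Inter_zero_locus_prime[OF fg pP] by blast
        then have eq: "\<Inter>Z = ?P"
          using factorial_domain_primeideal_below_prime_elem[OF fact pZ(1) _ lead(2) q] tail[OF Z(2)] lead(1) by blast
        have "Z \<subseteq> zero_locus (\<Inter>Z)" using pZ(2) unfolding zero_locus_def by blast
        then have "Z \<subseteq> zero_locus ?P" unfolding eq .
        then show ?thesis using Z(3) by blast
      qed
      ultimately have "zero_locus ?P \<in> irreducible_components ?T S"
        unfolding irreducible_components_def using irr by blast
      then have "2 \<le> codimension ?T (zero_locus ?P)" using R by blast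
      then show False using codimension_prime_divisor_less[OF fg fact q] by simp
    qed
  qed
qed

end
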